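(* Let $q\ge 1$ be an integer. For each integer $k_0\ge 1$, there is a local continuum of solutions $u=u(t,s)$, complex valued and $2\pi$-periodic in $t$ and in $s$, of the equation $$L(\omega)u+g(u)=0,\qquad L(\omega)u=-\frac{i}{q}\,\partial_t u-\partial_s^2u+\omega(u+\bar u),\qquad g(u)=\omega\frac{\bar u^{2}}{1+\bar u},$$ bifurcating from the unperturbed configuration $u=0$ with initial frequency $$\omega_0=-\frac1q\left(1-\frac{1}{2k_0^2q}\right).$$ The local bifurcation $(u,\omega)$ consists of standing waves satisfying the estimates $$u(t,s)=b\left[\cos j_0t+i\left(1-k_0^{-2}/q\right)\sin j_0t\right]\cos k_0s+\mathcal{O}(b^2),\qquad \omega=\omega_0+\mathcal{O}(b^2),$$ with $j_0=qk_0^2-1$, where $b\in[0,b_0]$ gives a local parameterization of the bifurcation curve. Furthermore, these solutions satisfy the symmetries $$u(t,s)=\bar u(-t,s)=u(t,-s).$$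
   Context: The real number $\omega<0$ (a frequency, written $\omega=-a^{-2}$ with amplitude $a$) is the bifurcation parameter. Solutions are sought in the Sobolev space $H^\sigma$, $\sigma>1$, of $2\pi$-periodic functions of $(t,s)$, with norm $\|u\|_{H^\sigma}^2=\sum_{(j,k)\in\mathbb{Z}^2}|u_{j,k}|^2(j^2+k^2+1)^\sigma$, where $u_{j,k}$ are the Fourier coefficients with respect to $e^{i(jt+ks)}$; the remainder in the expansion of $u$ is measured in this norm. Here $\bar u(-t,s)$ denotes the complex conjugate of $u(-t,s)$. Motivation: in the model of $n+1$ near-parallel vortex filaments, with $n$ filaments of circulation $1$ and a central one of circulation $-\kappa$ ($\kappa>0$), such $u$ are used to describe homographic standing waves $u_j(t,s)=ae^{i\omega t}(a_j+a_ju(t/q,s))$, $j=0,\dots,n$, where the complex numbers $a_j$ form a central configuration with $a_0=0$; $u=0$ corresponds to straight parallel filaments rotating uniformly with frequency $\omega$ around the central filament.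
   Formalization: The sine term in the leading profile is taken with a minus sign, cos j0 t − i(1 − k0^{-2}/q) sin j0 t; with the printed plus sign the profile is not in the kernel of L(ω0) when j0 > 0, so the printed estimate fails. *)

theory Defs
  imports "HOL-Analysis.Analysis"
begin

definition doubly_periodic :: "(real \<times> real \<Rightarrow> complex) \<Rightarrow> bool" where
  "doubly_periodic u \<longleftrightarrow> (\<forall>t s. u (t + 2 * pi, s) = u (t, s) \<and> u (t, s + 2 * pi) = u (t, s))"

definition period_cell :: "(real \<times> real) set" where
  "period_cell = cbox (0, 0) (2 * pi, 2 * pi)"

definition fourier_coeff :: "(real \<times> real \<Rightarrow> complex) \<Rightarrow> int \<times> int \<Rightarrow> complex" where
  "fourier_coeff u = (\<lambda>(j, k). complex_of_real (1 / (4 * pi\<^sup>2)) *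
     (LINT (t, s):period_cell|lborel.
        u (t, s) * exp (- \<i> * complex_of_real (of_int j * t + of_int k * s))))"

definition sobolev_term :: "real \<Rightarrow> (real \<times> real \<Rightarrow> complex) \<Rightarrow> int \<times> int \<Rightarrow> real" where
  "sobolev_term \<sigma> u = (\<lambda>(j, k). (cmod (fourier_coeff u (j, k)))\<^sup>2 *
     (real_of_int (j\<^sup>2 + k\<^sup>2 + 1)) powr \<sigma>)"

text \<open>Elements are functions rather than classes modulo null sets; solutions below are
  required to be the continuous representative, which exists and is unique for \<open>\<sigma> > 1\<close>.\<close>

definition sobolev_space :: "real \<Rightarrow> (real \<times> real \<Rightarrow> complex) set" where
  "sobolev_space \<sigma> = {u. doubly_periodic u \<and> u \<in> borel_measurable lborel \<and>
     set_integrable lborel period_cell (\<lambda>x. (cmod (u x))\<^sup>2) \<and>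
     sobolev_term \<sigma> u summable_on UNIV}"

definition sobolev_norm :: "real \<Rightarrow> (real \<times> real \<Rightarrow> complex) \<Rightarrow> real" where
  "sobolev_norm \<sigma> u = sqrt (\<Sum>\<^sub>\<infinity>p\<in>UNIV. sobolev_term \<sigma> u p)"

definition partial_t :: "(real \<times> real \<Rightarrow> complex) \<Rightarrow> real \<times> real \<Rightarrow> complex" where
  "partial_t \<phi> = (\<lambda>(t, s). vector_derivative (\<lambda>\<tau>. \<phi> (\<tau>, s)) (at t))"

definition partial_s :: "(real \<times> real \<Rightarrow> complex) \<Rightarrow> real \<times> real \<Rightarrow> complex" where
  "partial_s \<phi> = (\<lambda>(t, s). vector_derivative (\<lambda>\<tau>. \<phi> (t, \<tau>)) (at s))"

primrec C_k :: "nat \<Rightarrow> (real \<times> real \<Rightarrow> complex) \<Rightarrow> bool" where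
  "C_k 0 \<phi> \<longleftrightarrow> continuous_on UNIV \<phi>"
| "C_k (Suc n) \<phi> \<longleftrightarrow> continuous_on UNIV \<phi> \<and>
     (\<forall>t s. (\<lambda>\<tau>. \<phi> (\<tau>, s)) differentiable (at t) \<and>
            (\<lambda>\<tau>. \<phi> (t, \<tau>)) differentiable (at s)) \<and>
     C_k n (partial_t \<phi>) \<and> C_k n (partial_s \<phi>)"

definition test_function :: "(real \<times> real \<Rightarrow> complex) \<Rightarrow> bool" where
  "test_function \<phi> \<longleftrightarrow> doubly_periodic \<phi> \<and> (\<forall>n. C_k n \<phi>)"

definition g_nonlin :: "real \<Rightarrow> complex \<Rightarrow> complex" where
  "g_nonlin \<omega> z = complex_of_real \<omega> * (cnj z)\<^sup>2 / (1 + cnj z)"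

text \<open>For \<open>1 < \<sigma> \<le> 3\<close> the space \<open>H\<^sup>\<sigma>\<close> does not embed in \<open>C\<^sup>2\<close>, so the derivatives in
  \<open>L(\<omega>)u = -(i/q) u\<^sub>t - u\<^sub>s\<^sub>s + \<omega> (u + cnj u)\<close> are distributional. \<open>L_dist q \<omega> u \<phi>\<close> is the
  bilinear pairing of this distribution on the torus with the test function \<open>\<phi>\<close>; the first
  term changes sign under the integration by parts and the second does not.\<close>

definition L_dist :: "nat \<Rightarrow> real \<Rightarrow> (real \<times> real \<Rightarrow> complex) \<Rightarrow> (real \<times> real \<Rightarrow> complex) \<Rightarrow> complex" where
  "L_dist q \<omega> u \<phi> = (LINT x:period_cell|lborel.
       (\<i> / of_nat q) * u x * partial_t \<phi> x
       - u x * partial_s (partial_s \<phi>) x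
       + complex_of_real \<omega> * (u x + cnj (u x)) * \<phi> x)"

definition filament_solution :: "nat \<Rightarrow> real \<Rightarrow> (real \<times> real \<Rightarrow> complex) \<Rightarrow> bool" where
  "filament_solution q \<omega> u \<longleftrightarrow> doubly_periodic u \<and> continuous_on UNIV u \<and>
     (\<forall>x. 1 + cnj (u x) \<noteq> 0) \<and>
     (\<forall>\<phi>. test_function \<phi> \<longrightarrow>
        L_dist q \<omega> u \<phi> + (LINT x:period_cell|lborel. g_nonlin \<omega> (u x) * \<phi> x) = 0)"

definition omega0 :: "nat \<Rightarrow> nat \<Rightarrow> real" where
  "omega0 q k0 = - (1 / real q) * (1 - 1 / (2 * (real k0)\<^sup>2 * real q))"

text \<open>The sine term carries a minus sign. For \<open>v = (cos jt + i c sin jt) cos ks\<close> the imaginary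
  part of \<open>L(\<omega>)v\<close> is \<open>(j/q + c k\<^sup>2) sin jt cos ks\<close>, so \<open>L(\<omega>)v = 0\<close> with \<open>j = q k\<^sup>2 - 1 > 0\<close>
  forces \<open>c = - j / (q k\<^sup>2) = - (1 - 1 / (k\<^sup>2 q))\<close>, and then the real part vanishes exactly for
  \<open>\<omega> = omega0 q k\<close>. The opposite sign of \<open>c\<close>, which is sometimes printed, belongs to the equation
  with \<open>+(i/q) u\<^sub>t\<close>; with the operator above it cannot be the leading term of a branch
  of solutions.\<close>

definition leading_profile :: "nat \<Rightarrow> nat \<Rightarrow> real \<times> real \<Rightarrow> complex" where
  "leading_profile q k0 = (\<lambda>(t, s).
     let j0 = real q * (real k0)\<^sup>2 - 1 in
       (complex_of_real (cos (j0 * t))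
        - \<i> * complex_of_real ((1 - 1 / ((real k0)\<^sup>2 * real q)) * sin (j0 * t)))
       * complex_of_real (cos (real k0 * s)))"

end

theory Submission
  imports Defs
begin

text \<open>A Lyapunov-Schmidt reduction. The determinant of \<open>L(\<omega>\<^sub>0)\<close> on the modes \<open>(\<plusminus>j, k)\<close> vanishes only for
  \<open>(j\<^sub>0, k\<^sub>0)\<close> and is elsewhere bounded below by a multiple of \<open>\<bar>j\<bar> + k\<^sup>2\<close>, so \<open>L(\<omega>\<^sub>0)\<close> has a bounded
  inverse off a one-dimensional kernel. We work in an algebra of Fourier series whose coefficients decay
  exponentially, so that a single contraction argument serves all \<open>\<sigma>\<close>. Put
  \<open>u = b (\<phi> + b Y)\<close>, \<open>\<omega> = \<omega>\<^sub>0 + b\<^sup>2 m\<close> and \<open>g(u) = b\<^sup>2 (\<omega> (cnj \<phi>)\<^sup>2 + b V)\<close>, where \<open>\<phi>\<close> is the leading profile. Treating \<open>V\<close> as a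
  further unknown, determined by \<open>g(u) (1 + cnj u) = \<omega> (cnj u)\<^sup>2\<close>, makes the system for \<open>(Y, V, m)\<close>
  polynomial. The solvability condition determines \<open>m\<close>, because the square \<open>(cnj \<phi>)\<^sup>2\<close> has no component in
  the modes \<open>k = \<plusminus>k\<^sub>0\<close>.\<close>

section \<open>Exponentially weighted Fourier coefficients\<close>

text \<open>Conjugation is only real-linear, and translations in t and s would enlarge the kernel.
  Building both symmetries into the space removes both difficulties: with real coefficients, even in
  the second index, conjugation becomes the permutation (j, k) -> (-j, k) of the coefficients,
  L(\<omega>) splits into real symmetric 2x2 blocks, and the kernel is simple. The frequency enters
  L(\<omega>) only through the bounded term \<omega>(u + cnj u). So only the operator at the initial
  frequency is inverted, and the change of frequency joins the right-hand side. Boundedness of that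
  inverse suffices, since g contains no derivatives. The powers of b are forced. Squaring cos(k0 s)
  yields only the second indices 0 and +-2 k0, so order b^2 of the equation imposes no condition and
  the frequency has no term of order b. With the correction scaled as b^2 m, the solvability
  condition carries a common factor b. Cancelling it leaves an equation for m whose leading
  coefficient is nonzero at b = 0, so the implicit function theorem reduces to a
  contraction.\<close>

definition weight :: "int \<times> int \<Rightarrow> real" where
  "weight p = exp (of_int (\<bar>fst p\<bar> + \<bar>snd p\<bar>))"

lemma weight_ge_1: "1 \<le> weight p"
  by (simp add: weight_def)

lemma weight_pos [simp]: "0 < weight p"
  by (simp add: weight_def)

lemma weight_nonneg [simp]: "0 \<le> weight p"
  by (simp add: weight_def)

text \<open>Submultiplicativity, the triangle inequality in the exponent, is what makes the weighted
  space an algebra under convolution.\<close>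

lemma weight_add_le: "weight (p + r) \<le> weight p * weight r"
proof -
  have "\<bar>fst (p + r)\<bar> + \<bar>snd (p + r)\<bar> \<le> (\<bar>fst p\<bar> + \<bar>snd p\<bar>) + (\<bar>fst r\<bar> + \<bar>snd r\<bar>)"
    by simp
  then have "real_of_int (\<bar>fst (p + r)\<bar> + \<bar>snd (p + r)\<bar>)
      \<le> real_of_int ((\<bar>fst p\<bar> + \<bar>snd p\<bar>) + (\<bar>fst r\<bar> + \<bar>snd r\<bar>))"
    by (simp only: of_int_le_iff)
  then show ?thesis
    unfolding weight_def exp_add [symmetric] of_int_add [symmetric] exp_le_cancel_iff .
qed

definition weighted :: "(int \<times> int \<Rightarrow> real) \<Rightarrow> int \<times> int \<Rightarrow> real" where
  "weighted f p = \<bar>f p\<bar> * weight p"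

lemma weighted_nonneg [simp]: "0 \<le> weighted f p"
  by (simp add: weighted_def)

lemma weighted_add_le: "weighted (\<lambda>p. f p + g p) p \<le> weighted f p + weighted g p"
  unfolding weighted_def ring_distribs(2) [symmetric]
  by (intro mult_right_mono) auto

lemma weighted_scale: "weighted (\<lambda>p. c * f p) p = \<bar>c\<bar> * weighted f p"
  by (simp add: weighted_def abs_mult)

text \<open>Real coefficients encode the symmetry \<open>u(t,s) = cnj (u(-t,s))\<close> and evenness in the second
  index encodes \<open>u(t,s) = u(t,-s)\<close>. The weight dominates every Sobolev weight, so one space
  serves all \<open>\<sigma>\<close>.\<close>

typedef wiener = "{f :: int \<times> int \<Rightarrow> real. (\<forall>j k. f (j, - k) = f (j, k)) \<and> weighted f summable_on UNIV}"
  morphisms coef Abs_wiener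
  by (rule exI [of _ "\<lambda>_. 0"]) (simp add: weighted_def [abs_def])

setup_lifting type_definition_wiener

lemma coef_even: "coef f (j, - k) = coef f (j, k)"
  using coef [of f] by simp

lemma coef_summable: "weighted (coef f) summable_on UNIV"
  using coef [of f] by simp

lemma wiener_eqI: "(\<And>p. coef f p = coef g p) \<Longrightarrow> f = g"
  by (metis coef_inject ext)

instantiation wiener :: real_vector
begin

lift_definition zero_wiener :: wiener is "\<lambda>_. 0"
  by (simp add: weighted_def [abs_def])

lift_definition plus_wiener :: "wiener \<Rightarrow> wiener \<Rightarrow> wiener" is "\<lambda>f g p. f p + g p"
proof safe
  fix f g :: "int \<times> int \<Rightarrow> real"
  assume "weighted f summable_on UNIV" "weighted g summable_on UNIV"
  then have "(\<lambda>p. weighted f p + weighted g p) summable_on UNIV"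
    by (rule summable_on_add)
  then show "weighted (\<lambda>p. f p + g p) summable_on UNIV"
    by (rule summable_on_comparison_test) (auto intro: weighted_add_le)
qed auto

lift_definition scaleR_wiener :: "real \<Rightarrow> wiener \<Rightarrow> wiener" is "\<lambda>c f p. c * f p"
  by (auto simp: weighted_scale [abs_def] intro!: summable_on_cmult_right)

lift_definition uminus_wiener :: "wiener \<Rightarrow> wiener" is "\<lambda>f p. - f p"
  by (auto simp: weighted_def [abs_def])

definition minus_wiener :: "wiener \<Rightarrow> wiener \<Rightarrow> wiener" where
  "minus_wiener f g = f + - g"

lemma coef_0 [simp]: "coef 0 p = 0"
  by transfer simp

lemma coef_add [simp]: "coef (f + g) p = coef f p + coef g p"
  by transfer simp

lemma coef_uminus [simp]: "coef (- f) p = - coef f p"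
  by transfer simp

lemma coef_diff [simp]: "coef (f - g) p = coef f p - coef g p"
  by (simp add: minus_wiener_def plus_wiener.rep_eq uminus_wiener.rep_eq)

lemma coef_scaleR [simp]: "coef (c *\<^sub>R f) p = c * coef f p"
  by transfer simp

instance
  by standard (rule wiener_eqI, simp add: algebra_simps)+

end

instantiation wiener :: real_normed_vector
begin

definition norm_wiener :: "wiener \<Rightarrow> real" where
  "norm_wiener f = (\<Sum>\<^sub>\<infinity>p. weighted (coef f) p)"

definition sgn_wiener :: "wiener \<Rightarrow> wiener" where
  "sgn_wiener f = inverse (norm f) *\<^sub>R f"

definition dist_wiener :: "wiener \<Rightarrow> wiener \<Rightarrow> real" where
  "dist_wiener f g = norm (f - g)"

definition uniformity_wiener :: "(wiener \<times> wiener) filter" where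
  "uniformity_wiener = (INF e\<in>{0<..}. principal {(f, g). dist f g < e})"

definition open_wiener :: "wiener set \<Rightarrow> bool" where
  "open_wiener U \<longleftrightarrow> (\<forall>x\<in>U. \<forall>\<^sub>F (x', y) in uniformity. x' = x \<longrightarrow> y \<in> U)"

instance
proof
  fix f g :: wiener and c :: real
  show "norm f = 0 \<longleftrightarrow> f = 0"
  proof
    assume "norm f = 0"
    then have "weighted (coef f) p = 0" for p
      using nonneg_infsum_le_0D [OF _ coef_summable, of f p] by (simp add: norm_wiener_def)
    then show "f = 0"
      by (intro wiener_eqI) (simp add: weighted_def order.strict_implies_not_eq [OF weight_pos, symmetric])
  qed (simp add: norm_wiener_def weighted_def [abs_def])
  have "norm (f + g) \<le> (\<Sum>\<^sub>\<infinity>p. weighted (coef f) p + weighted (coef g) p)"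
    unfolding norm_wiener_def
    by (intro infsum_mono coef_summable summable_on_add)
      (use weighted_add_le in \<open>simp add: weighted_def\<close>)
  also have "\<dots> = norm f + norm g"
    unfolding norm_wiener_def by (intro infsum_add coef_summable)
  finally show "norm (f + g) \<le> norm f + norm g" .
  have "weighted (coef (c *\<^sub>R f)) = (\<lambda>p. \<bar>c\<bar> * weighted (coef f) p)"
    by (auto simp: weighted_def abs_mult)
  then show "norm (c *\<^sub>R f) = \<bar>c\<bar> * norm f"
    unfolding norm_wiener_def by (simp add: infsum_cmult_right')
qed (rule sgn_wiener_def dist_wiener_def uniformity_wiener_def open_wiener_def)+

end

lemma sum_weighted_le_norm: "finite F \<Longrightarrow> (\<Sum>p\<in>F. weighted (coef f) p) \<le> norm f"
  unfolding norm_wiener_def by (intro finite_sum_le_infsum coef_summable) auto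

lemma weighted_le_norm: "weighted (coef f) p \<le> norm f"
  using sum_weighted_le_norm [of "{p}" f] by simp

lemma abs_coef_le_norm: "\<bar>coef f p\<bar> \<le> norm f"
proof -
  have "\<bar>coef f p\<bar> * 1 \<le> weighted (coef f) p"
    unfolding weighted_def by (intro mult_left_mono weight_ge_1) auto
  then show ?thesis
    using weighted_le_norm [of f p] by simp
qed

lemma bounded_linear_coef: "bounded_linear (\<lambda>f. coef f p)"
  by (rule bounded_linear_intro [where K = 1]) (auto simp: abs_coef_le_norm)

lemma norm_wiener_leI:
  assumes "\<And>F. finite F \<Longrightarrow> (\<Sum>p\<in>F. weighted (coef f) p) \<le> B"
  shows "norm f \<le> B"
  unfolding norm_wiener_def by (rule infsum_le_finite_sums) (use coef_summable assms in auto)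

instance wiener :: banach
proof
  fix X :: "nat \<Rightarrow> wiener"
  assume X: "Cauchy X"
  have "convergent (\<lambda>n. coef (X n) p)" for p
    using bounded_linear.Cauchy [OF bounded_linear_coef X] by (rule Cauchy_convergent)
  then obtain g where g: "\<And>p. (\<lambda>n. coef (X n) p) \<longlonglongrightarrow> g p"
    unfolding convergent_def by metis
  \<comment> \<open>The coefficientwise limit \<open>g\<close> is not yet known to lie in the space,
    so closeness to it is expressed by finite partial sums, where the limit in \<open>m\<close> may
    be taken term by term.\<close>
  have tail: "\<exists>N. \<forall>n\<ge>N. \<forall>F. finite F \<longrightarrow> (\<Sum>p\<in>F. weighted (\<lambda>p. coef (X n) p - g p) p) \<le> e"
    if e: "e > 0" for e
  proof -
    obtain N where N: "\<And>m n. N \<le> m \<Longrightarrow> N \<le> n \<Longrightarrow> norm (X n - X m) < e"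
      using CauchyD [OF X e] by blast
    have "(\<Sum>p\<in>F. weighted (\<lambda>p. coef (X n) p - g p) p) \<le> e" if "N \<le> n" "finite F" for n F
    proof (rule LIMSEQ_le_const2)
      show "(\<lambda>m. \<Sum>p\<in>F. weighted (\<lambda>p. coef (X n) p - coef (X m) p) p)
          \<longlonglongrightarrow> (\<Sum>p\<in>F. weighted (\<lambda>p. coef (X n) p - g p) p)"
        unfolding weighted_def by (intro tendsto_intros g)
      have "(\<Sum>p\<in>F. weighted (\<lambda>p. coef (X n) p - coef (X m) p) p) \<le> e" if "N \<le> m" for m
        using sum_weighted_le_norm [OF \<open>finite F\<close>, of "X n - X m"] N [OF that \<open>N \<le> n\<close>]
        by (simp add: weighted_def)
      then show "\<exists>M. \<forall>m\<ge>M. (\<Sum>p\<in>F. weighted (\<lambda>p. coef (X n) p - coef (X m) p) p) \<le> e"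
        by blast
    qed
    then show ?thesis by blast
  qed
  have even: "g (j, - k) = g (j, k)" for j k
    using g [of "(j, - k)"] g [of "(j, k)"] by (simp add: coef_even LIMSEQ_unique)
  obtain N where N: "\<And>F. finite F \<Longrightarrow> (\<Sum>p\<in>F. weighted (\<lambda>p. coef (X N) p - g p) p) \<le> 1"
    using tail [of 1] by auto
  have "weighted (\<lambda>p. coef (X N) p - g p) summable_on UNIV"
    by (rule nonneg_bounded_partial_sums_imp_summable_on [where C = 1])
      (auto intro: N)
  then have "(\<lambda>p. weighted (coef (X N)) p + weighted (\<lambda>p. coef (X N) p - g p) p) summable_on UNIV"
    by (intro summable_on_add coef_summable)
  then have "weighted g summable_on UNIV"
  proof (rule summable_on_comparison_test)
    show "weighted g p \<le> weighted (coef (X N)) p + weighted (\<lambda>p. coef (X N) p - g p) p" for p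
      unfolding weighted_def ring_distribs(2) [symmetric] by (intro mult_right_mono) auto
  qed auto
  with even have g': "coef (Abs_wiener g) = g"
    by (simp add: Abs_wiener_inverse)
  have "X \<longlonglongrightarrow> Abs_wiener g"
  proof (rule metric_LIMSEQ_I)
    fix e :: real assume "e > 0"
    then obtain N where N: "\<And>n F. n \<ge> N \<Longrightarrow> finite F \<Longrightarrow>
        (\<Sum>p\<in>F. weighted (\<lambda>p. coef (X n) p - g p) p) \<le> e / 2"
      using tail [of "e / 2"] by auto
    have "norm (X n - Abs_wiener g) \<le> e / 2" if "n \<ge> N" for n
      by (rule norm_wiener_leI) (use N [OF that] g' in \<open>simp add: weighted_def\<close>)
    then show "\<exists>N. \<forall>n\<ge>N. dist (X n) (Abs_wiener g) < e"
      unfolding dist_norm using \<open>e > 0\<close> by (intro exI [of _ N]) force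
  qed
  then show "convergent X"
    by (auto simp: convergent_def)
qed

section \<open>Convolution and Fourier series\<close>

no_notation Infinite_Set_Sum.abs_summable_on (infix \<open>abs'_summable'_on\<close> 50)

text \<open>The shear (p, r) -> (r, p - r) is a bijection that turns the double sum into a product
  of two absolutely convergent sums; summing by rows gives the convolution. The codomain is general
  because the lemma serves both the real weighted coefficients and the complex terms of Fourier
  series.\<close>

lemma abs_summable_convolution:
  fixes F G :: "'a::ab_group_add \<Rightarrow> 'b::{real_normed_field, banach}"
  assumes F: "F abs_summable_on UNIV" and G: "G abs_summable_on UNIV"
  shows "(\<lambda>(p, r). F r * G (p - r)) abs_summable_on UNIV \<times> UNIV" (is ?abs)
    and "((\<lambda>p. \<Sum>\<^sub>\<infinity>r. F r * G (p - r)) has_sum (infsum F UNIV * infsum G UNIV)) UNIV" (is ?sum)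
proof -
  have FG: "(\<lambda>(r, s). F r * G s) abs_summable_on UNIV \<times> UNIV"
  proof (intro iffD2 [OF Infinite_Sum.abs_summable_on_Sigma_iff] conjI ballI)
    show "(\<lambda>s. case (r, s) of (r, s) \<Rightarrow> F r * G s) abs_summable_on UNIV" for r
      using G by (simp add: norm_mult summable_on_cmult_right)
    show "(\<lambda>r. \<Sum>\<^sub>\<infinity>s. norm (case (r, s) of (r, s) \<Rightarrow> F r * G s)) abs_summable_on UNIV"
      using F by (simp add: norm_mult infsum_cmult_right' abs_mult infsum_nonneg summable_on_cmult_left)
  qed
  then show A: ?abs
    by (subst summable_on_reindex_bij_witness
        [where j = "\<lambda>(p, r). (r, p - r)" and i = "\<lambda>(r, s). (r + s, r)"
          and T = "UNIV \<times> UNIV" and h = "\<lambda>(r, s). norm (F r * G s)"])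
      (auto simp: case_prod_unfold)
  have "((\<lambda>(r, s). F r * G s) has_sum (infsum F UNIV * infsum G UNIV)) (UNIV \<times> UNIV)"
    using infsum_Sigma_banach [OF abs_summable_summable [OF FG]] abs_summable_summable [OF FG]
    by (simp add: has_sum_iff infsum_cmult_right' infsum_cmult_left')
  then have B: "((\<lambda>(p, r). F r * G (p - r)) has_sum (infsum F UNIV * infsum G UNIV)) (UNIV \<times> UNIV)"
    by (rule iffD1 [OF has_sum_reindex_bij_witness
        [where i = "\<lambda>(p, r). (r, p - r)" and j = "\<lambda>(r, s). (r + s, r)" and S = "UNIV \<times> UNIV"], rotated -1])
      auto
  have "((\<lambda>r. F r * G (p - r)) has_sum (\<Sum>\<^sub>\<infinity>r. F r * G (p - r))) UNIV" for p
    using Infinite_Sum.abs_summable_on_Sigma_iff [THEN iffD1, OF A]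
    by (intro has_sum_infsum, intro abs_summable_summable [where f = "\<lambda>r. F r * G (p - r)"]) simp
  then show ?sum
    by (intro has_sum_SigmaD [OF B]) auto
qed

lemma abs_summable_convolution_slice:
  fixes F G :: "'a::ab_group_add \<Rightarrow> 'b::{real_normed_field, banach}"
  assumes "F abs_summable_on UNIV" and "G abs_summable_on UNIV"
  shows "(\<lambda>r. F r * G (p - r)) abs_summable_on UNIV"
  using Infinite_Sum.abs_summable_on_Sigma_iff [THEN iffD1, OF abs_summable_convolution(1) [OF assms]] by simp

text \<open>By \<open>weight_add_le\<close> the weight of p is split between r and p - r, so a
  weighted convolution is dominated by the convolution of the weighted sequences. The last bound is
  the Banach algebra inequality.\<close>

lemma weighted_convolution:
  assumes f: "weighted f summable_on UNIV" and g: "weighted g summable_on UNIV"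
  shows "weighted (\<lambda>p. \<Sum>\<^sub>\<infinity>r. f r * g (p - r)) p \<le> (\<Sum>\<^sub>\<infinity>r. weighted f r * weighted g (p - r))"
    and "weighted (\<lambda>p. \<Sum>\<^sub>\<infinity>r. f r * g (p - r)) summable_on UNIV"
    and "infsum (weighted (\<lambda>p. \<Sum>\<^sub>\<infinity>r. f r * g (p - r))) UNIV
      \<le> infsum (weighted f) UNIV * infsum (weighted g) UNIV"
proof -
  let ?c = "\<lambda>p. \<Sum>\<^sub>\<infinity>r. f r * g (p - r)"
  have abs: "weighted f abs_summable_on UNIV" "weighted g abs_summable_on UNIV"
    using f g by simp_all
  have le: "\<bar>f r * g (p - r)\<bar> * weight p \<le> weighted f r * weighted g (p - r)" for p r
  proof -
    have "\<bar>f r * g (p - r)\<bar> * weight (r + (p - r))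
        \<le> \<bar>f r * g (p - r)\<bar> * (weight r * weight (p - r))"
      by (intro mult_left_mono weight_add_le) auto
    then show ?thesis
      by (simp add: weighted_def abs_mult mult_ac)
  qed
  show main: "weighted ?c p \<le> (\<Sum>\<^sub>\<infinity>r. weighted f r * weighted g (p - r))" for p
  proof -
    have S: "(\<lambda>r. weighted f r * weighted g (p - r)) summable_on UNIV"
      by (rule abs_summable_summable [OF abs_summable_convolution_slice [OF abs]])
    have S': "(\<lambda>r. \<bar>f r * g (p - r)\<bar> * weight p) summable_on UNIV"
      by (rule summable_on_comparison_test [OF S]) (auto intro: le)
    then have "(\<lambda>r. \<bar>f r * g (p - r)\<bar>) summable_on UNIV"
      using summable_on_cmult_left' [of "weight p" "\<lambda>r. \<bar>f r * g (p - r)\<bar>" UNIV]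
      by (simp add: less_imp_neq [OF weight_pos, symmetric])
    then have "\<bar>?c p\<bar> \<le> (\<Sum>\<^sub>\<infinity>r. \<bar>f r * g (p - r)\<bar>)"
      using norm_infsum_bound [of "\<lambda>r. f r * g (p - r)" UNIV] by simp
    then have "weighted ?c p \<le> (\<Sum>\<^sub>\<infinity>r. \<bar>f r * g (p - r)\<bar>) * weight p"
      by (simp add: weighted_def mult_right_mono)
    also have "\<dots> = (\<Sum>\<^sub>\<infinity>r. \<bar>f r * g (p - r)\<bar> * weight p)"
      by (rule infsum_cmult_left' [symmetric])
    also have "\<dots> \<le> (\<Sum>\<^sub>\<infinity>r. weighted f r * weighted g (p - r))"
      by (rule infsum_mono [OF S' S le])
    finally show ?thesis .
  qed
  have sum: "((\<lambda>p. \<Sum>\<^sub>\<infinity>r. weighted f r * weighted g (p - r)) has_sum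
      (infsum (weighted f) UNIV * infsum (weighted g) UNIV)) UNIV"
    by (rule abs_summable_convolution(2) [OF abs])
  show s: "weighted ?c summable_on UNIV"
    by (rule summable_on_comparison_test [OF has_sum_imp_summable [OF sum]]) (auto intro: main)
  show "infsum (weighted ?c) UNIV \<le> infsum (weighted f) UNIV * infsum (weighted g) UNIV"
    using infsum_mono [OF s has_sum_imp_summable [OF sum] main] infsumI [OF sum] by simp
qed

lift_definition conv :: "wiener \<Rightarrow> wiener \<Rightarrow> wiener" is "\<lambda>f g p. \<Sum>\<^sub>\<infinity>r. f r * g (p - r)"
proof safe
  fix f g :: "int \<times> int \<Rightarrow> real" and j k
  assume f: "\<forall>j k. f (j, - k) = f (j, k)" and g: "\<forall>j k. g (j, - k) = g (j, k)"
  show "(\<Sum>\<^sub>\<infinity>r. f r * g ((j, - k) - r)) = (\<Sum>\<^sub>\<infinity>r. f r * g ((j, k) - r))"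
  proof (rule infsum_reindex_bij_witness
      [where j = "\<lambda>(a, b). (a, - b)" and i = "\<lambda>(a, b). (a, - b)"])
    show "f (case r of (a, b) \<Rightarrow> (a, - b)) * g ((j, k) - (case r of (a, b) \<Rightarrow> (a, - b)))
        = f r * g ((j, - k) - r)" for r
    proof (cases r)
      case (Pair a b)
      have "g (j - a, k + b) = g (j - a, - (k + b))"
        using g by metis
      then show ?thesis
        using f by (simp add: Pair)
    qed
  qed auto
qed (rule weighted_convolution(2))

lemma coef_conv: "coef (conv f g) p = (\<Sum>\<^sub>\<infinity>r. coef f r * coef g (p - r))"
  by transfer simp

lemma norm_conv_le: "norm (conv f g) \<le> norm f * norm g"
  using weighted_convolution(3) [OF coef_summable coef_summable, of f g]
  unfolding norm_wiener_def coef_conv [abs_def] .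

lemma coef_abs_summable: "coef f abs_summable_on UNIV"
proof (rule summable_on_comparison_test [OF coef_summable])
  show "norm (coef f p) \<le> weighted (coef f) p" for p
    using mult_left_mono [OF weight_ge_1, of "\<bar>coef f p\<bar>" p] by (simp add: weighted_def)
qed auto

lemma coef_conv_summable: "(\<lambda>r. coef f r * coef g (p - r)) summable_on UNIV"
  by (rule abs_summable_summable [OF abs_summable_convolution_slice]) (rule coef_abs_summable)+

lemma bounded_bilinear_conv: "bounded_bilinear conv"
proof
  show "conv (f + g) h = conv f h + conv g h" for f g h
    by (rule wiener_eqI) (simp add: coef_conv ring_distribs infsum_add coef_conv_summable)
  show "conv f (g + h) = conv f g + conv f h" for f g h
    by (rule wiener_eqI) (simp add: coef_conv ring_distribs infsum_add coef_conv_summable)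
  show "conv (c *\<^sub>R f) g = c *\<^sub>R conv f g" for c f g
    by (rule wiener_eqI) (simp add: coef_conv mult.assoc infsum_cmult_right')
  show "conv f (c *\<^sub>R g) = c *\<^sub>R conv f g" for c f g
    by (rule wiener_eqI) (simp add: coef_conv mult.left_commute infsum_cmult_right')
  show "\<exists>K. \<forall>f g. norm (conv f g) \<le> norm f * norm g * K"
    by (rule exI [of _ 1]) (simp add: norm_conv_le)
qed

text \<open>Conjugating a function moves its coefficients from p to -p and conjugates them. For real
  coefficients that are even in the second index this is the same as reversing the first index only,
  so \<open>time_reverse\<close> below represents complex conjugation.\<close>

definition flip :: "int \<times> int \<Rightarrow> int \<times> int" where
  "flip p = (- fst p, snd p)"

lemma flip_flip [simp]: "flip (flip p) = p"
  by (simp add: flip_def)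

lemma weight_flip [simp]: "weight (flip p) = weight p"
  by (simp add: flip_def weight_def)

lemma infsum_flip: "(\<Sum>\<^sub>\<infinity>p. f (flip p)) = infsum f UNIV"
  by (rule infsum_reindex_bij_witness [where i = flip and j = flip]) auto

lemma summable_on_flip: "(\<lambda>p. f (flip p)) summable_on UNIV \<longleftrightarrow> f summable_on UNIV"
  by (rule summable_on_reindex_bij_witness [where i = flip and j = flip]) auto

lemma weighted_flip: "weighted (\<lambda>p. f (flip p)) p = weighted f (flip p)"
  by (simp add: weighted_def)

lift_definition time_reverse :: "wiener \<Rightarrow> wiener" is "\<lambda>f p. f (flip p)"
  by (simp add: weighted_flip [abs_def] summable_on_flip) (simp add: flip_def)

lemma coef_time_reverse [simp]: "coef (time_reverse f) p = coef f (flip p)"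
  by transfer simp

lemma norm_time_reverse [simp]: "norm (time_reverse f) = norm f"
  by (simp add: norm_wiener_def weighted_flip [abs_def] infsum_flip [where f = "weighted (coef f)", symmetric]
      time_reverse.rep_eq)

lemma bounded_linear_time_reverse: "bounded_linear time_reverse"
  by (rule bounded_linear_intro [where K = 1]) (auto intro: wiener_eqI)

section \<open>Fourier series as functions on the torus\<close>

definition mode :: "int \<times> int \<Rightarrow> real \<times> real \<Rightarrow> complex" where
  "mode p x = cis (of_int (fst p) * fst x + of_int (snd p) * snd x)"

lemma norm_mode [simp]: "norm (mode p x) = 1"
  by (simp add: mode_def)

lemma mode_add: "mode (p + r) x = mode p x * mode r x"
  by (simp add: mode_def cis_mult algebra_simps)

lemma continuous_on_mode [continuous_intros]: "continuous_on A (mode p)"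
  unfolding mode_def [abs_def] by (intro continuous_intros)

definition fourier_sum :: "wiener \<Rightarrow> real \<times> real \<Rightarrow> complex" where
  "fourier_sum f x = (\<Sum>\<^sub>\<infinity>p. complex_of_real (coef f p) * mode p x)"

lemma mode_abs_summable: "(\<lambda>p. complex_of_real (coef f p) * mode p x) abs_summable_on UNIV"
  using coef_abs_summable [of f] by (simp add: norm_mult)

lemma fourier_sum_has_sum:
  "((\<lambda>p. complex_of_real (coef f p) * mode p x) has_sum fourier_sum f x) UNIV"
  unfolding fourier_sum_def by (rule has_sum_infsum [OF abs_summable_summable [OF mode_abs_summable]])

lemma fourier_sum_eqI:
  "((\<lambda>p. complex_of_real (coef f p) * mode p x) has_sum y) UNIV \<Longrightarrow> fourier_sum f x = y"
  using fourier_sum_has_sum has_sum_unique by blast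

lemma fourier_sum_0 [simp]: "fourier_sum 0 x = 0"
  by (simp add: fourier_sum_def)

lemma fourier_sum_add: "fourier_sum (f + g) x = fourier_sum f x + fourier_sum g x"
  by (rule fourier_sum_eqI)
    (use has_sum_add [OF fourier_sum_has_sum fourier_sum_has_sum] in \<open>simp add: ring_distribs\<close>)

lemma fourier_sum_scaleR: "fourier_sum (c *\<^sub>R f) x = of_real c * fourier_sum f x"
  by (rule fourier_sum_eqI)
    (use has_sum_cmult_right [OF fourier_sum_has_sum] in \<open>simp add: mult.assoc\<close>)

lemma fourier_sum_diff: "fourier_sum (f - g) x = fourier_sum f x - fourier_sum g x"
  using fourier_sum_add [of "f - g" g x] by simp

lemma fourier_sum_conv: "fourier_sum (conv f g) x = fourier_sum f x * fourier_sum g x"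
proof (rule fourier_sum_eqI)
  have "complex_of_real (coef (conv f g) p) * mode p x
      = (\<Sum>\<^sub>\<infinity>r. complex_of_real (coef f r) * mode r x * (complex_of_real (coef g (p - r)) * mode (p - r) x))" for p
  proof -
    have e: "complex_of_real (coef f r) * mode r x * (complex_of_real (coef g (p - r)) * mode (p - r) x)
        = complex_of_real (coef f r * coef g (p - r)) * mode p x" for r
      using mode_add [of r "p - r" x] by simp
    have "(\<Sum>\<^sub>\<infinity>r. complex_of_real (coef f r * coef g (p - r))) = complex_of_real (coef (conv f g) p)"
      unfolding coef_conv
      by (intro infsumI has_sum_of_real has_sum_infsum coef_conv_summable)
    then show ?thesis
      unfolding e infsum_cmult_left' by simp
  qed
  then show "((\<lambda>p. complex_of_real (coef (conv f g) p) * mode p x) has_sum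
      fourier_sum f x * fourier_sum g x) UNIV"
    using abs_summable_convolution(2) [OF mode_abs_summable mode_abs_summable, of f x g x]
    by (simp add: fourier_sum_def)
qed

lemma fourier_sum_time_reverse: "fourier_sum (time_reverse f) x = cnj (fourier_sum f x)"
proof -
  define neg :: "int \<times> int \<Rightarrow> int \<times> int" where "neg p = - p" for p
  have "coef f (flip p) = coef f (- p)" for p
    using coef_even [of f "- fst p" "snd p"] by (simp add: flip_def uminus_prod_def)
  moreover have "mode (- p) x = cnj (mode p x)" for p
    by (simp add: mode_def cis_cnj)
  ultimately have "complex_of_real (coef (time_reverse f) p) * mode p x
      = cnj (complex_of_real (coef f (- p)) * mode (- p) x)" for p
    by simp
  then have "fourier_sum (time_reverse f) x = cnj (\<Sum>\<^sub>\<infinity>p. complex_of_real (coef f (- p)) * mode (- p) x)"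
    unfolding fourier_sum_def infsum_cnj [symmetric] by simp
  also have "(\<Sum>\<^sub>\<infinity>p. complex_of_real (coef f (- p)) * mode (- p) x) = fourier_sum f x"
    unfolding fourier_sum_def
    by (rule infsum_reindex_bij_witness [where i = uminus and j = uminus]) auto
  finally show ?thesis .
qed

lemma fourier_sum_even: "fourier_sum f (t, - s) = fourier_sum f (t, s)"
  unfolding fourier_sum_def
  by (rule infsum_reindex_bij_witness [where j = "\<lambda>(a, b). (a, - b)" and i = "\<lambda>(a, b). (a, - b)"])
    (auto simp: coef_even mode_def algebra_simps)

text \<open>Real coefficients relate (t, s) to (-t, -s) by conjugation; evenness in s then restores
  the sign of s.\<close>

lemma fourier_sum_reflect: "cnj (fourier_sum f (- t, s)) = fourier_sum f (t, s)"
proof -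
  have "cnj (fourier_sum f (- t, s)) = cnj (fourier_sum f (- t, - s))"
    by (simp add: fourier_sum_even)
  also have "\<dots> = fourier_sum f (t, s)"
    unfolding fourier_sum_def infsum_cnj [symmetric]
    by (rule infsum_cong) (simp add: mode_def cis_cnj add.commute)
  finally show ?thesis .
qed

lemma norm_fourier_sum_le: "norm (fourier_sum f x) \<le> norm f"
proof -
  have "norm (fourier_sum f x) \<le> (\<Sum>\<^sub>\<infinity>p. norm (complex_of_real (coef f p) * mode p x))"
    unfolding fourier_sum_def by (rule norm_infsum_bound [OF mode_abs_summable])
  also have "\<dots> \<le> norm f"
    unfolding norm_wiener_def
  proof (rule infsum_mono [OF mode_abs_summable coef_summable])
    show "norm (complex_of_real (coef f p) * mode p x) \<le> weighted (coef f) p" for p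
      using mult_left_mono [OF weight_ge_1, of "\<bar>coef f p\<bar>" p] by (simp add: weighted_def norm_mult)
  qed
  finally show ?thesis .
qed

lemma cis_of_int_2pi: "cis (of_int n * (y + 2 * pi)) = cis (of_int n * y)"
  using cis_multiple_2pi [of "of_int n"]
  by (simp add: ring_distribs cis_mult [symmetric] mult_ac)

lemma doubly_periodic_mode: "doubly_periodic (mode p)"
  unfolding doubly_periodic_def mode_def by (simp add: cis_mult [symmetric] cis_of_int_2pi)

lemma doubly_periodic_fourier_sum: "doubly_periodic (fourier_sum f)"
  using doubly_periodic_mode unfolding doubly_periodic_def fourier_sum_def by simp

lemma uniform_limit_fourier_sum:
  "uniform_limit UNIV (\<lambda>X x. \<Sum>p\<in>X. complex_of_real (coef f p) * mode p x) (fourier_sum f)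
    (finite_subsets_at_top UNIV)"
  by (rule Weierstrass_m_test_general' [where M = "\<lambda>p. norm (coef f p)"])
    (auto simp: norm_mult fourier_sum_has_sum coef_abs_summable [simplified])

lemma continuous_on_fourier_sum [continuous_intros]: "continuous_on A (fourier_sum f)"
proof -
  have "continuous_on UNIV (fourier_sum f)"
    by (rule uniform_limit_theorem [OF _ uniform_limit_fourier_sum])
      (auto intro!: always_eventually continuous_intros)
  then show ?thesis
    using continuous_on_subset by blast
qed

section \<open>Integration over the period cell\<close>

lemma period_cell_set_integrable:
  fixes f :: "real \<times> real \<Rightarrow> 'b::{banach, second_countable_topology}"
  assumes "continuous_on UNIV f"
  shows "set_integrable lborel period_cell f"
  unfolding set_integrable_def period_cell_def
  by (rule borel_integrable_compact) (use assms continuous_on_subset in auto)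

lemma period_cell_integral:
  fixes f :: "real \<times> real \<Rightarrow> complex"
  assumes "continuous_on UNIV f"
  shows "(LINT x:period_cell|lborel. f x) = integral (cbox (0, 0) (2 * pi, 2 * pi)) f"
  using set_borel_integral_eq_integral(2) [OF period_cell_set_integrable [OF assms]]
  by (simp add: period_cell_def)

text \<open>The fundamental theorem on each line, with equal boundary values, followed by Fubini. It
  is used both for the orthogonality of the modes and for integration by parts against test
  functions.\<close>

lemma integral_t_derivative_eq_0:
  assumes per: "doubly_periodic G" and cont: "continuous_on UNIV H"
    and G: "\<And>t s. ((\<lambda>\<tau>. G (\<tau>, s)) has_vector_derivative H (t, s)) (at t)"
  shows "(LINT x:period_cell|lborel. H x) = 0"
proof -
  have H: "continuous_on (cbox (0, 0) (2 * pi, 2 * pi)) H"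
    using cont continuous_on_subset by blast
  have "integral (cbox 0 (2 * pi)) (\<lambda>t. H (t, s)) = 0" for s
  proof -
    have "((\<lambda>t. H (t, s)) has_integral (G (2 * pi, s) - G (0, s))) {0..2 * pi}"
      by (rule fundamental_theorem_of_calculus) (auto intro: has_vector_derivative_at_within G)
    moreover have "G (2 * pi, s) = G (0, s)"
      using per unfolding doubly_periodic_def by (metis add_0)
    ultimately show ?thesis
      by (simp add: integral_unique)
  qed
  moreover have "integral (cbox (0, 0) (2 * pi, 2 * pi)) H
      = integral (cbox 0 (2 * pi)) (\<lambda>s. integral (cbox 0 (2 * pi)) (\<lambda>t. H (t, s)))"
    using integral_prod_continuous [OF H] integral_swap_continuous [of 0 0 "2 * pi" "2 * pi" "\<lambda>t s. H (t, s)"] H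
    by simp
  ultimately show ?thesis
    by (simp add: period_cell_integral [OF cont])
qed

lemma integral_s_derivative_eq_0:
  assumes per: "doubly_periodic G" and cont: "continuous_on UNIV H"
    and G: "\<And>t s. ((\<lambda>\<tau>. G (t, \<tau>)) has_vector_derivative H (t, s)) (at s)"
  shows "(LINT x:period_cell|lborel. H x) = 0"
proof -
  have H: "continuous_on (cbox (0, 0) (2 * pi, 2 * pi)) H"
    using cont continuous_on_subset by blast
  have "integral (cbox 0 (2 * pi)) (\<lambda>s. H (t, s)) = 0" for t
  proof -
    have "((\<lambda>s. H (t, s)) has_integral (G (t, 2 * pi) - G (t, 0))) {0..2 * pi}"
      by (rule fundamental_theorem_of_calculus) (auto intro: has_vector_derivative_at_within G)
    moreover have "G (t, 2 * pi) = G (t, 0)"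
      using per unfolding doubly_periodic_def by (metis add_0)
    ultimately show ?thesis
      by (simp add: integral_unique)
  qed
  then show ?thesis
    using integral_prod_continuous [OF H] by (simp add: period_cell_integral [OF cont])
qed

lemma mode_has_t_derivative:
  "((\<lambda>\<tau>. mode p (\<tau>, s)) has_vector_derivative (\<i> * of_int (fst p) * mode p (t, s))) (at t)"
  unfolding mode_def has_vector_derivative_def
  by (auto intro!: derivative_eq_intros simp: fun_eq_iff scaleR_conv_of_real mult_ac)

lemma mode_has_s_derivative:
  "((\<lambda>\<tau>. mode p (t, \<tau>)) has_vector_derivative (\<i> * of_int (snd p) * mode p (t, s))) (at s)"
  unfolding mode_def has_vector_derivative_def
  by (auto intro!: derivative_eq_intros simp: fun_eq_iff scaleR_conv_of_real mult_ac)

text \<open>If one index is nonzero, the mode is, up to a nonzero factor, a derivative of itself in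
  that variable, so its mean vanishes.\<close>

lemma integral_mode:
  "(LINT x:period_cell|lborel. mode p x) = (if p = 0 then 4 * pi\<^sup>2 else 0)"
proof (cases "p = 0")
  case True
  have "(LINT x:period_cell|lborel. mode p x) = integral (cbox (0, 0) (2 * pi, 2 * pi)) (\<lambda>_::real \<times> real. 1 :: complex)"
    using True by (subst period_cell_integral) (auto simp: mode_def [abs_def] intro!: continuous_intros)
  also have "\<dots> = of_real (4 * pi\<^sup>2)"
    by (simp add: content_Pair power2_eq_square scaleR_conv_of_real del: cbox_Pair_eq)
  finally show ?thesis
    using True by simp
next
  case False
  then consider "fst p \<noteq> 0" | "snd p \<noteq> 0"
    by (auto simp: prod_eq_iff)
  then have "(LINT x:period_cell|lborel. mode p x) = 0"
  proof cases
    case 1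
    have "(LINT x:period_cell|lborel. \<i> * of_int (fst p) * mode p x) = 0"
      by (rule integral_t_derivative_eq_0 [OF doubly_periodic_mode])
        (auto intro: mode_has_t_derivative intro!: continuous_intros)
    with 1 show ?thesis by simp
  next
    case 2
    have "(LINT x:period_cell|lborel. \<i> * of_int (snd p) * mode p x) = 0"
      by (rule integral_s_derivative_eq_0 [OF doubly_periodic_mode])
        (auto intro: mode_has_s_derivative intro!: continuous_intros)
    with 2 show ?thesis by simp
  qed
  with False show ?thesis by simp
qed

text \<open>Uniform convergence on the compact cell, with majorant |coef| times a bound of the test
  factor, allows termwise integration. It yields the Fourier coefficients of a series and later
  reduces the weak equation to one scalar equation per mode.\<close>

lemma fourier_sum_pairing_has_sum:
  assumes \<psi>: "continuous_on UNIV \<psi>"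
  shows "((\<lambda>p. complex_of_real (coef f p) * (LINT x:period_cell|lborel. mode p x * \<psi> x)) has_sum
    (LINT x:period_cell|lborel. fourier_sum f x * \<psi> x)) UNIV"
proof -
  let ?C = "cbox (0, 0) (2 * pi, 2 * pi) :: (real \<times> real) set"
  have "compact (\<psi> ` ?C)"
    by (intro compact_continuous_image continuous_on_subset [OF \<psi>]) auto
  then obtain B where B: "\<And>x. x \<in> ?C \<Longrightarrow> norm (\<psi> x) \<le> B"
    using compact_imp_bounded bounded_iff by (metis imageI)
  have int: "integral ?C (\<lambda>x. mode p x * \<psi> x) = (LINT x:period_cell|lborel. mode p x * \<psi> x)" for p
    by (rule period_cell_integral [symmetric]) (intro continuous_intros \<psi>)
  have "uniform_limit ?C (\<lambda>X x. \<Sum>p\<in>X. complex_of_real (coef f p) * (mode p x * \<psi> x))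
      (\<lambda>x. fourier_sum f x * \<psi> x) (finite_subsets_at_top UNIV)"
  proof (rule Weierstrass_m_test_general' [where M = "\<lambda>p. norm (coef f p) * B"])
    show "norm (complex_of_real (coef f p) * (mode p x * \<psi> x)) \<le> norm (coef f p) * B" if "x \<in> ?C" for p x
      using B [OF that] by (simp add: norm_mult mult_left_mono)
    show "((\<lambda>p. complex_of_real (coef f p) * (mode p x * \<psi> x)) has_sum fourier_sum f x * \<psi> x) UNIV" for x
      using has_sum_cmult_left [OF fourier_sum_has_sum] by (simp add: mult.assoc)
    show "(\<lambda>p. norm (coef f p) * B) summable_on UNIV"
      by (intro summable_on_cmult_left coef_abs_summable)
  qed
  moreover have "continuous_on ?C (\<lambda>x. \<Sum>p\<in>X. complex_of_real (coef f p) * (mode p x * \<psi> x))" for X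
    by (intro continuous_intros continuous_on_subset [OF \<psi>]) auto
  ultimately obtain I J where I: "\<And>X. ((\<lambda>x. \<Sum>p\<in>X. complex_of_real (coef f p) * (mode p x * \<psi> x)) has_integral I X) ?C"
    and J: "((\<lambda>x. fourier_sum f x * \<psi> x) has_integral J) ?C" and IJ: "(I \<longlongrightarrow> J) (finite_subsets_at_top UNIV)"
    by (rule uniform_limit_integral_cbox) (auto simp: finite_subsets_at_top_neq_bot)
  have "J = (LINT x:period_cell|lborel. fourier_sum f x * \<psi> x)"
    using J by (subst period_cell_integral) (auto intro!: continuous_intros \<psi> simp: integral_unique)
  moreover have "I X = (\<Sum>p\<in>X. complex_of_real (coef f p) * (LINT x:period_cell|lborel. mode p x * \<psi> x))"
    if "finite X" for X
  proof -
    have "((\<lambda>x. \<Sum>p\<in>X. complex_of_real (coef f p) * (mode p x * \<psi> x)) has_integral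
        (\<Sum>p\<in>X. complex_of_real (coef f p) * integral ?C (\<lambda>x. mode p x * \<psi> x))) ?C"
      by (intro has_integral_sum that has_integral_mult_right integrable_integral integrable_continuous
          continuous_intros continuous_on_subset [OF \<psi>]) auto
    with I [of X] show ?thesis
      by (simp only: int) (rule has_integral_unique)
  qed
  ultimately show ?thesis
    using IJ unfolding has_sum_def
    by (subst (asm) tendsto_cong [where g = "sum (\<lambda>p. complex_of_real (coef f p) *
        (LINT x:period_cell|lborel. mode p x * \<psi> x))"])
      (auto intro: eventually_finite_subsets_at_top_weakI)
qed

section \<open>Comparison with the Sobolev norms\<close>

lemma fourier_coeff_fourier_sum: "fourier_coeff (fourier_sum f) p = coef f p"
proof -
  have exp: "exp (- \<i> * complex_of_real (of_int (fst p) * t + of_int (snd p) * s)) = mode (- p) (t, s)" for t s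
    by (simp add: mode_def cis_conv_exp algebra_simps)
  have "((\<lambda>r. complex_of_real (coef f r) * (LINT x:period_cell|lborel. mode r x * mode (- p) x)) has_sum
      (LINT x:period_cell|lborel. fourier_sum f x * mode (- p) x)) UNIV"
    by (rule fourier_sum_pairing_has_sum) (rule continuous_on_mode)
  moreover have "(LINT x:period_cell|lborel. mode r x * mode (- p) x) = (if r = p then 4 * pi\<^sup>2 else 0)" for r
    using integral_mode [of "r - p"] mode_add [of r "- p"] by simp
  ultimately have "((\<lambda>r. complex_of_real (coef f r) * (if r = p then 4 * pi\<^sup>2 else 0)) has_sum
      (LINT x:period_cell|lborel. fourier_sum f x * mode (- p) x)) UNIV"
    by simp
  moreover have "((\<lambda>r. complex_of_real (coef f r) * (if r = p then 4 * pi\<^sup>2 else 0)) has_sum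
      complex_of_real (coef f p) * (4 * pi\<^sup>2)) UNIV"
    by (rule has_sum_finite_neutralI [where B = "{p}"]) auto
  ultimately have "(LINT x:period_cell|lborel. fourier_sum f x * mode (- p) x) = complex_of_real (coef f p) * (4 * pi\<^sup>2)"
    by (rule has_sum_unique)
  moreover have "fourier_coeff (fourier_sum f) p
      = of_real (1 / (4 * pi\<^sup>2)) * (LINT x:period_cell|lborel. fourier_sum f x * mode (- p) x)"
    unfolding fourier_coeff_def case_prod_unfold exp prod.collapse ..
  ultimately show ?thesis
    by simp
qed

text \<open>The constant is n^n for an integer n >= \<sigma>: pulling n out of each factor of (1 +
  x)^n leaves at most (1 + x/n)^n, which is below exp x.\<close>

lemma powr_le_exp:
  fixes \<sigma> :: real
  shows "\<exists>K. \<forall>x\<ge>0. (1 + x) powr \<sigma> \<le> K * exp x"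
proof -
  obtain n :: nat where n: "\<sigma> \<le> n" "0 < n"
    using that real_arch_simple [of "max 1 \<sigma>"] by fastforce
  have "(1 + x) powr \<sigma> \<le> real n ^ n * exp x" if "0 \<le> x" for x
  proof -
    have "(1 + x) powr \<sigma> \<le> (1 + x) powr n"
      using that n by (intro powr_mono) auto
    also have "\<dots> = (1 + x) ^ n"
      using that by (simp add: powr_realpow)
    also have "\<dots> \<le> (real n * (1 + x / real n)) ^ n"
      using that n by (intro power_mono) (auto simp: field_simps)
    also have "\<dots> = real n ^ n * (1 + x / real n) ^ n"
      by (rule power_mult_distrib)
    also have "\<dots> \<le> real n ^ n * exp x"
      using that n by (intro mult_left_mono exp_ge_one_plus_x_over_n_power_n) auto
    finally show ?thesis .
  qed
  then show ?thesis by blast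
qed

lemma sobolev_weight_le:
  "\<exists>K>0. \<forall>p. (real_of_int ((fst p)\<^sup>2 + (snd p)\<^sup>2 + 1)) powr \<sigma> \<le> (K * weight p)\<^sup>2" if "0 \<le> \<sigma>"
proof -
  obtain K where K: "\<And>x. x \<ge> 0 \<Longrightarrow> (1 + x) powr \<sigma> \<le> K * exp x"
    using powr_le_exp by blast
  have K1: "1 \<le> K"
    using K [of 0] by simp
  have "(real_of_int ((fst p)\<^sup>2 + (snd p)\<^sup>2 + 1)) powr \<sigma> \<le> (K * weight p)\<^sup>2" for p
  proof -
    define x where "x = real_of_int (\<bar>fst p\<bar> + \<bar>snd p\<bar>)"
    have x: "x \<ge> 0" by (simp add: x_def)
    have "real_of_int ((fst p)\<^sup>2 + (snd p)\<^sup>2 + 1) \<le> (1 + x)\<^sup>2"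
      unfolding x_def by (simp add: power2_eq_square algebra_simps)
    then have "(real_of_int ((fst p)\<^sup>2 + (snd p)\<^sup>2 + 1)) powr \<sigma> \<le> ((1 + x)\<^sup>2) powr \<sigma>"
      using that by (intro powr_mono2) auto
    also have "\<dots> = ((1 + x) powr \<sigma>)\<^sup>2"
      using x by (simp add: power2_eq_square powr_mult)
    also have "\<dots> \<le> (K * exp x)\<^sup>2"
      using K [OF x] by (intro power_mono) auto
    finally show ?thesis
      by (simp add: weight_def x_def)
  qed
  with K1 show ?thesis
    by (intro exI [of _ K]) auto
qed

text \<open>An l^1 norm controls an l^2 norm: each Sobolev term is at most K^2 times a squared
  weighted coefficient, and one of the two factors is bounded by the norm.\<close>

lemma sobolev_fourier_sum:
  assumes "0 \<le> \<sigma>"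
  shows "\<exists>K>0. \<forall>f. fourier_sum f \<in> sobolev_space \<sigma> \<and> sobolev_norm \<sigma> (fourier_sum f) \<le> K * norm f"
proof -
  obtain K where K: "K > 0" "\<And>p. (real_of_int ((fst p)\<^sup>2 + (snd p)\<^sup>2 + 1)) powr \<sigma> \<le> (K * weight p)\<^sup>2"
    using sobolev_weight_le [OF assms] by auto
  have "fourier_sum f \<in> sobolev_space \<sigma> \<and> sobolev_norm \<sigma> (fourier_sum f) \<le> K * norm f" for f
  proof -
    have term_eq: "sobolev_term \<sigma> (fourier_sum f) p
        = \<bar>coef f p\<bar>\<^sup>2 * (real_of_int ((fst p)\<^sup>2 + (snd p)\<^sup>2 + 1)) powr \<sigma>" for p
      by (simp add: sobolev_term_def case_prod_unfold fourier_coeff_fourier_sum)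
    have le: "sobolev_term \<sigma> (fourier_sum f) p \<le> K\<^sup>2 * norm f * weighted (coef f) p" for p
    proof -
      have "sobolev_term \<sigma> (fourier_sum f) p \<le> \<bar>coef f p\<bar>\<^sup>2 * (K * weight p)\<^sup>2"
        unfolding term_eq by (intro mult_left_mono K) auto
      also have "\<dots> = K\<^sup>2 * weighted (coef f) p * weighted (coef f) p"
        by (simp add: weighted_def power2_eq_square)
      also have "\<dots> \<le> K\<^sup>2 * norm f * weighted (coef f) p"
        by (intro mult_right_mono mult_left_mono weighted_le_norm) auto
      finally show ?thesis .
    qed
    have sum: "sobolev_term \<sigma> (fourier_sum f) summable_on UNIV"
    proof (rule summable_on_comparison_test)
      show "(\<lambda>p. K\<^sup>2 * norm f * weighted (coef f) p) summable_on UNIV"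
        by (intro summable_on_cmult_right coef_summable)
      show "0 \<le> sobolev_term \<sigma> (fourier_sum f) p" for p
        by (simp add: term_eq)
    qed (rule le)
    have "(\<Sum>\<^sub>\<infinity>p. sobolev_term \<sigma> (fourier_sum f) p) \<le> (\<Sum>\<^sub>\<infinity>p. K\<^sup>2 * norm f * weighted (coef f) p)"
      by (intro infsum_mono sum le summable_on_cmult_right coef_summable)
    also have "\<dots> = (K * norm f)\<^sup>2"
      unfolding infsum_cmult_right' norm_wiener_def [symmetric] by (simp add: power2_eq_square mult_ac)
    finally have "sobolev_norm \<sigma> (fourier_sum f) \<le> K * norm f"
      unfolding sobolev_norm_def using K(1) by (intro real_le_lsqrt) auto
    moreover have "fourier_sum f \<in> sobolev_space \<sigma>"
      unfolding sobolev_space_def mem_Collect_eq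
      by (intro conjI doubly_periodic_fourier_sum sum period_cell_set_integrable
          borel_measurable_continuous_onI [where f = "fourier_sum f", THEN measurable_lborel2 [THEN equalityD2, THEN subsetD]]
          continuous_intros)
    ultimately show ?thesis by blast
  qed
  with K(1) show ?thesis by blast
qed

section \<open>From coefficient equations to distributional solutions\<close>

lemma C_k_derivatives:
  assumes "C_k (Suc n) \<phi>"
  shows "continuous_on UNIV \<phi>" "continuous_on UNIV (partial_t \<phi>)" "continuous_on UNIV (partial_s \<phi>)"
    and "((\<lambda>\<tau>. \<phi> (\<tau>, s)) has_vector_derivative partial_t \<phi> (t, s)) (at t)"
    and "((\<lambda>\<tau>. \<phi> (t, \<tau>)) has_vector_derivative partial_s \<phi> (t, s)) (at s)"
    and "C_k n (partial_s \<phi>)"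
proof -
  have C: "continuous_on UNIV \<psi>" if "C_k m \<psi>" for m \<psi>
    using that by (cases m) auto
  show "continuous_on UNIV \<phi>" "continuous_on UNIV (partial_t \<phi>)" "continuous_on UNIV (partial_s \<phi>)"
    "C_k n (partial_s \<phi>)"
    using assms by (auto intro: C)
  show "((\<lambda>\<tau>. \<phi> (\<tau>, s)) has_vector_derivative partial_t \<phi> (t, s)) (at t)"
    "((\<lambda>\<tau>. \<phi> (t, \<tau>)) has_vector_derivative partial_s \<phi> (t, s)) (at s)"
    using assms by (auto simp: partial_t_def partial_s_def vector_derivative_works)
qed

lemma doubly_periodic_partial_s:
  assumes per: "doubly_periodic \<phi>" and "C_k (Suc 0) \<phi>"
  shows "doubly_periodic (partial_s \<phi>)"
proof -
  note D = C_k_derivatives(5) [OF assms(2)]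
  have "partial_s \<phi> (t, s + 2 * pi) = partial_s \<phi> (t, s)" for t s
  proof (rule vector_derivative_unique_at [OF _ D])
    have "(((\<lambda>\<tau>. \<phi> (t, \<tau>)) \<circ> (\<lambda>\<tau>. \<tau> + 2 * pi)) has_vector_derivative 1 *\<^sub>R partial_s \<phi> (t, s + 2 * pi)) (at s)"
      by (rule vector_diff_chain_at [OF _ D]) (auto intro!: derivative_eq_intros)
    then show "((\<lambda>\<tau>. \<phi> (t, \<tau>)) has_vector_derivative partial_s \<phi> (t, s + 2 * pi)) (at s)"
      using per by (simp add: o_def doubly_periodic_def)
  qed
  then show ?thesis
    using per by (simp add: doubly_periodic_def partial_s_def)
qed

lemma doubly_periodic_mult:
  "doubly_periodic u \<Longrightarrow> doubly_periodic v \<Longrightarrow> doubly_periodic (\<lambda>x. u x * v x)"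
  by (simp add: doubly_periodic_def)

lemma mode_partial_t:
  assumes "doubly_periodic \<phi>" "C_k (Suc 0) \<phi>"
  shows "(LINT x:period_cell|lborel. mode p x * partial_t \<phi> x)
    = - \<i> * of_int (fst p) * (LINT x:period_cell|lborel. mode p x * \<phi> x)"
proof -
  note \<phi> = C_k_derivatives [OF assms(2)]
  note [continuous_intros] = \<phi>(1,2)
  have "(LINT x:period_cell|lborel. mode p x * partial_t \<phi> x + \<i> * of_int (fst p) * mode p x * \<phi> x) = 0"
    by (rule integral_t_derivative_eq_0 [OF doubly_periodic_mult [OF doubly_periodic_mode [of p] assms(1)]])
      (intro continuous_intros has_vector_derivative_mult mode_has_t_derivative \<phi>)+
  also have "(LINT x:period_cell|lborel. mode p x * partial_t \<phi> x + \<i> * of_int (fst p) * mode p x * \<phi> x)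
     = (LINT x:period_cell|lborel. mode p x * partial_t \<phi> x)
      + \<i> * of_int (fst p) * (LINT x:period_cell|lborel. mode p x * \<phi> x)"
    by (subst set_integral_add(2)) (auto intro!: period_cell_set_integrable continuous_intros simp: mult.assoc)
  finally show ?thesis
    by (simp add: eq_neg_iff_add_eq_0)
qed

lemma mode_partial_s:
  assumes "doubly_periodic \<phi>" "C_k (Suc 0) \<phi>"
  shows "(LINT x:period_cell|lborel. mode p x * partial_s \<phi> x)
    = - \<i> * of_int (snd p) * (LINT x:period_cell|lborel. mode p x * \<phi> x)"
proof -
  note \<phi> = C_k_derivatives [OF assms(2)]
  note [continuous_intros] = \<phi>(1,3)
  have "(LINT x:period_cell|lborel. mode p x * partial_s \<phi> x + \<i> * of_int (snd p) * mode p x * \<phi> x) = 0"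
    by (rule integral_s_derivative_eq_0 [OF doubly_periodic_mult [OF doubly_periodic_mode [of p] assms(1)]])
      (intro continuous_intros has_vector_derivative_mult mode_has_s_derivative \<phi>)+
  also have "(LINT x:period_cell|lborel. mode p x * partial_s \<phi> x + \<i> * of_int (snd p) * mode p x * \<phi> x)
     = (LINT x:period_cell|lborel. mode p x * partial_s \<phi> x)
      + \<i> * of_int (snd p) * (LINT x:period_cell|lborel. mode p x * \<phi> x)"
    by (subst set_integral_add(2)) (auto intro!: period_cell_set_integrable continuous_intros simp: mult.assoc)
  finally show ?thesis
    by (simp add: eq_neg_iff_add_eq_0)
qed


text \<open>The nonlinearity is represented by a second element \<open>g\<close> tied to
  \<open>f\<close> by a polynomial identity; the quotient is recovered only pointwise, from
  \<open>nz\<close>. Moving the derivatives onto the test function and expanding in modes, the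
  contribution of p is the left side of \<open>lin\<close> times the pairing of mode p with the test
  function.\<close>

lemma filament_solution_fourier_sum:
  assumes lin: "\<And>p. (of_int (fst p) / real q + (of_int (snd p))\<^sup>2) * coef f p
      + \<omega> * (coef f p + coef f (flip p)) + coef g p = 0"
    and nonlin: "\<And>x. fourier_sum g x * (1 + cnj (fourier_sum f x)) = of_real \<omega> * (cnj (fourier_sum f x))\<^sup>2"
    and nz: "\<And>x. 1 + cnj (fourier_sum f x) \<noteq> 0"
  shows "filament_solution q \<omega> (fourier_sum f)"
  unfolding filament_solution_def
proof (intro conjI allI impI doubly_periodic_fourier_sum continuous_on_fourier_sum nz)
  fix \<phi> assume "test_function \<phi>"
  then have per: "doubly_periodic \<phi>" and C: "C_k n \<phi>" for n
    by (auto simp: test_function_def)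
  have Cs: "C_k (Suc 0) (partial_s \<phi>)"
    using C_k_derivatives(6) [OF C] .
  note [continuous_intros] = C_k_derivatives(1-3) [OF C] C_k_derivatives(3) [OF Cs]
  let ?m = "\<lambda>p. LINT x:period_cell|lborel. mode p x * \<phi> x"
  let ?\<psi> = "\<lambda>x. (\<i> / of_nat q) * partial_t \<phi> x - partial_s (partial_s \<phi>) x"
  \<comment> \<open>Collects all terms without derivatives, so that only two series have to be
    paired with the test function.\<close>
  define w where "w = \<omega> *\<^sub>R (f + time_reverse f) + g"
  have w: "fourier_sum w x = of_real \<omega> * (fourier_sum f x + cnj (fourier_sum f x)) + g_nonlin \<omega> (fourier_sum f x)" for x
    using nonlin [of x] nz [of x]
    by (simp add: w_def fourier_sum_add fourier_sum_scaleR fourier_sum_time_reverse g_nonlin_def eq_divide_eq)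
  have \<psi>: "(LINT x:period_cell|lborel. mode p x * ?\<psi> x)
      = of_real (of_int (fst p) / real q + (of_int (snd p))\<^sup>2) * ?m p" for p
  proof -
    have "(LINT x:period_cell|lborel. mode p x * ?\<psi> x)
        = (LINT x:period_cell|lborel. (\<i> / of_nat q) * (mode p x * partial_t \<phi> x)
            - mode p x * partial_s (partial_s \<phi>) x)"
      by (simp add: algebra_simps)
    also have "\<dots> = (\<i> / of_nat q) * (LINT x:period_cell|lborel. mode p x * partial_t \<phi> x)
            - (LINT x:period_cell|lborel. mode p x * partial_s (partial_s \<phi>) x)"
      by (subst set_integral_diff(2)) (auto intro!: period_cell_set_integrable continuous_intros simp del: times_divide_eq_left)
    also have "\<dots> = of_real (of_int (fst p) / real q + (of_int (snd p))\<^sup>2) * ?m p"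
      unfolding mode_partial_t [OF per C] mode_partial_s [OF doubly_periodic_partial_s [OF per C] Cs]
        mode_partial_s [OF per C]
      by (simp add: power2_eq_square algebra_simps)
    finally show ?thesis .
  qed
  have "((\<lambda>p. complex_of_real (coef f p) * (LINT x:period_cell|lborel. mode p x * ?\<psi> x)
        + complex_of_real (coef w p) * ?m p) has_sum
      (LINT x:period_cell|lborel. fourier_sum f x * ?\<psi> x) + (LINT x:period_cell|lborel. fourier_sum w x * \<phi> x)) UNIV"
    by (intro has_sum_add fourier_sum_pairing_has_sum continuous_intros)
  moreover have "complex_of_real (coef f p) * (LINT x:period_cell|lborel. mode p x * ?\<psi> x)
        + complex_of_real (coef w p) * ?m p = 0" for p
  proof -
    have "complex_of_real (coef f p) * (LINT x:period_cell|lborel. mode p x * ?\<psi> x)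
        + complex_of_real (coef w p) * ?m p
      = of_real ((of_int (fst p) / real q + (of_int (snd p))\<^sup>2) * coef f p
          + \<omega> * (coef f p + coef f (flip p)) + coef g p) * ?m p"
      unfolding \<psi> by (simp add: w_def algebra_simps)
    then show ?thesis
      unfolding lin by simp
  qed
  ultimately have 0: "(LINT x:period_cell|lborel. fourier_sum f x * ?\<psi> x)
      + (LINT x:period_cell|lborel. fourier_sum w x * \<phi> x) = 0"
    by (intro has_sum_unique [OF _ has_sum_0_simp]) (simp only:)
  have [continuous_intros]: "continuous_on UNIV (\<lambda>x. g_nonlin \<omega> (fourier_sum f x))"
    unfolding g_nonlin_def by (intro continuous_intros) (use nz in auto)
  have "L_dist q \<omega> (fourier_sum f) \<phi> + (LINT x:period_cell|lborel. g_nonlin \<omega> (fourier_sum f x) * \<phi> x)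
      = (LINT x:period_cell|lborel. fourier_sum f x * ?\<psi> x + fourier_sum w x * \<phi> x)"
    unfolding L_dist_def
    by (subst set_integral_add(2) [symmetric], (intro period_cell_set_integrable continuous_intros)+)
      (simp add: w algebra_simps)
  also have "\<dots> = 0"
    unfolding 0 [symmetric]
    by (rule set_integral_add(2)) (intro period_cell_set_integrable continuous_intros)+
  finally show "L_dist q \<omega> (fourier_sum f) \<phi> + (LINT x:period_cell|lborel. g_nonlin \<omega> (fourier_sum f x) * \<phi> x) = 0" .
qed

section \<open>The linearised operator\<close>

text \<open>A 2x2 block on each pair of modes p, \<open>flip p\<close>: \<open>a\<close> holds the
  diagonal and \<open>b\<close> the off-diagonal entries. \<open>Abs_wiener\<close> is meaningful
  here for even and bounded entries, as assumed in the context that follows.\<close>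

definition matrix_multiplier :: "(int \<times> int \<Rightarrow> real) \<Rightarrow> (int \<times> int \<Rightarrow> real) \<Rightarrow> wiener \<Rightarrow> wiener" where
  "matrix_multiplier a b f = Abs_wiener (\<lambda>p. a p * coef f p + b p * coef f (flip p))"

context
  fixes a b :: "int \<times> int \<Rightarrow> real" and C :: real
  assumes even: "\<And>j k. a (j, - k) = a (j, k)" "\<And>j k. b (j, - k) = b (j, k)"
    and bound: "\<And>p. \<bar>a p\<bar> \<le> C" "\<And>p. \<bar>b p\<bar> \<le> C"
begin

lemma weighted_matrix_multiplier_le:
  "weighted (\<lambda>p. a p * coef f p + b p * coef f (flip p)) p
    \<le> C * (weighted (coef f) p + weighted (coef f) (flip p))"
proof -
  have "\<bar>a p * coef f p + b p * coef f (flip p)\<bar> \<le> \<bar>a p\<bar> * \<bar>coef f p\<bar> + \<bar>b p\<bar> * \<bar>coef f (flip p)\<bar>"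
    by (metis abs_mult abs_triangle_ineq)
  also have "\<dots> \<le> C * \<bar>coef f p\<bar> + C * \<bar>coef f (flip p)\<bar>"
    by (intro add_mono mult_right_mono bound) auto
  finally have "\<bar>a p * coef f p + b p * coef f (flip p)\<bar> * weight p
      \<le> (C * \<bar>coef f p\<bar> + C * \<bar>coef f (flip p)\<bar>) * weight p"
    by (rule mult_right_mono) simp
  then show ?thesis
    by (simp add: weighted_def algebra_simps)
qed

lemma flip_sum:
  "((\<lambda>p. C * (weighted (coef f) p + weighted (coef f) (flip p))) has_sum C * (norm f + norm f)) UNIV"
proof -
  have "((\<lambda>p. weighted (coef f) p + weighted (coef f) (flip p)) has_sum norm f + norm f) UNIV"
    unfolding norm_wiener_def
    by (intro has_sum_add has_sum_infsum coef_summable)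
      (use coef_summable in \<open>simp add: has_sum_iff summable_on_flip infsum_flip\<close>)
  then show ?thesis
    by (rule has_sum_cmult_right)
qed

lemma coef_matrix_multiplier [simp]:
  "coef (matrix_multiplier a b f) p = a p * coef f p + b p * coef f (flip p)"
proof -
  have "weighted (\<lambda>p. a p * coef f p + b p * coef f (flip p)) summable_on UNIV"
    by (rule summable_on_comparison_test [OF has_sum_imp_summable [OF flip_sum]])
      (auto intro: weighted_matrix_multiplier_le)
  then show ?thesis
    unfolding matrix_multiplier_def
    by (subst Abs_wiener_inverse) (auto simp: even coef_even flip_def)
qed

lemma bounded_linear_matrix_multiplier: "bounded_linear (matrix_multiplier a b)"
proof (rule bounded_linear_intro [where K = "2 * C"])
  show "norm (matrix_multiplier a b f) \<le> norm f * (2 * C)" for f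
  proof -
    have "norm (matrix_multiplier a b f)
        \<le> (\<Sum>\<^sub>\<infinity>p. C * (weighted (coef f) p + weighted (coef f) (flip p)))"
      unfolding norm_wiener_def
      by (rule infsum_mono [OF coef_summable has_sum_imp_summable [OF flip_sum]])
        (simp add: coef_matrix_multiplier [abs_def] weighted_matrix_multiplier_le)
    also have "\<dots> = C * (norm f + norm f)"
      by (rule infsumI [OF flip_sum])
    finally show ?thesis by (simp add: algebra_simps)
  qed
qed (rule wiener_eqI; simp add: algebra_simps)+

end

text \<open>Here \<open>A\<close> stands for \<open>k\<^sub>0\<^sup>2\<close>, \<open>K\<close> for \<open>k\<^sup>2\<close> and \<open>J\<close> for \<open>\<bar>j\<bar>\<close>; the integer on the right is
  \<open>k\<^sub>0\<^sup>2 q\<^sup>2\<close> times the determinant of \<open>L(\<omega>\<^sub>0)\<close> on the modes \<open>(\<plusminus>j, k)\<close>. There are no small divisors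
  because on the resonant curve \<open>\<bar>j\<bar> = q k\<^sup>2 - 1\<close> the determinant still grows like \<open>k\<^sup>2 - k\<^sub>0\<^sup>2\<close>.\<close>

lemma determinant_lower_bound:
  fixes q A K J :: int
  assumes q: "q \<ge> 1" and A: "A \<ge> 1" and K: "K \<ge> 0" and J: "J \<ge> 0"
    and nz: "K \<noteq> 0 \<or> J \<noteq> 0" and nres: "\<not> (K = A \<and> J = q * A - 1)"
  shows "K + J \<le> (1 + q) * (A + 1) * \<bar>A * ((q * K - 1)\<^sup>2 - J\<^sup>2) + K - A\<bar>"
    (is "_ \<le> ?C * \<bar>?Z\<bar>")
proof -
  \<comment> \<open>J = m is the curve on which the quadratic part of the determinant factors to
    zero; off it, integrality gives |J - m| >= 1.\<close>
  define m where "m = q * K - 1"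
  have Z: "?Z = A * ((m - J) * (m + J)) + K - A"
    by (simp add: m_def power2_eq_square algebra_simps)
  have C: "?C \<ge> 1 + q" "?C \<ge> 2"
  proof -
    have "(1 + q) * 1 \<le> ?C" using q A by (intro mult_left_mono) auto
    then show C: "?C \<ge> 1 + q" by simp
    then show "?C \<ge> 2" using q by linarith
  qed
  have up: "K + J \<le> ?C * \<bar>?Z\<bar>" if "K + J \<le> c * \<bar>?Z\<bar>" "c \<le> ?C" for c
    using that by (meson abs_ge_zero mult_right_mono order_trans)
  \<comment> \<open>For K = 0 the expression is -A J^2. Above the curve K <= J and the negative part
    dominates J; below it J <= q K and the expression is at least K. On the curve only K - A
    remains.\<close>
  consider "K = 0" | "K \<ge> 1" "J \<ge> m + 1" | "K \<ge> 1" "J \<le> m - 1" | "K \<ge> 1" "J = m"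
    using K by linarith
  then show ?thesis
  proof cases
    case 1
    then have J1: "J \<ge> 1" using nz J by auto
    have "J * 1 \<le> J * (J * A)"
      using J1 A mult_mono [of 1 J 1 A] by (intro mult_left_mono) auto
    then have "K + J \<le> 1 * \<bar>?Z\<bar>"
      using 1 by (simp add: power2_eq_square algebra_simps)
    then show ?thesis by (rule up) (use C q in auto)
  next
    case 2
    have qK: "q * K \<ge> K" using q K by (simp add: mult_le_cancel_right1)
    have mJ: "m + J \<ge> 0" "1 \<le> J - m"
      using 2 qK J unfolding m_def by linarith+
    then have "1 * (m + J) \<le> (J - m) * (m + J)"
      by (intro mult_right_mono)
    then have "A * (m + J) \<le> A * ((J - m) * (m + J))"
      using A by (intro mult_left_mono) auto
    moreover have "1 * (J + q * K) \<le> A * (J + q * K)"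
      using A qK J K by (intro mult_right_mono) auto
    ultimately have "J \<le> - ?Z"
      using qK unfolding Z by (simp add: m_def algebra_simps)
    moreover have "K + J \<le> 2 * \<bar>z\<bar>" if "J \<le> - z" for z
      using that 2 qK unfolding m_def by linarith
    ultimately have "K + J \<le> 2 * \<bar>?Z\<bar>"
      by blast
    then show ?thesis by (rule up) (use C in auto)
  next
    case 3
    have "1 * 1 \<le> (m - J) * (m + J)"
      using 3 J by (intro mult_mono) auto
    then have "1 \<le> (m - J) * (m + J)"
      by simp
    then have "A * 1 \<le> A * ((m - J) * (m + J))"
      using A by (intro mult_left_mono) auto
    then have "K \<le> \<bar>?Z\<bar>"
      unfolding Z by simp
    then have "K + J \<le> (1 + q) * \<bar>?Z\<bar>"
      using 3 q mult_left_mono [of K "\<bar>?Z\<bar>" "1 + q"] by (simp add: m_def algebra_simps)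
    then show ?thesis by (rule up) (use C in auto)
  next
    case 4
    then have Z': "?Z = K - A" unfolding Z by simp
    have ne: "K \<noteq> A" using nres 4 by (auto simp: m_def)
    \<comment> \<open>Source of the factor A + 1: for K > A, (A + 1)(K - A) - K = A (K - A - 1) >=
      0, and for K < A the distance is at least 1.\<close>
    have "K \<le> (A + 1) * \<bar>K - A\<bar>"
    proof (cases "K < A")
      case True
      then have "(A + 1) * 1 \<le> (A + 1) * \<bar>K - A\<bar>" using A by (intro mult_left_mono) auto
      with True show ?thesis by simp
    next
      case False
      then have "A * (A + 1) \<le> A * K" using A ne by (intro mult_left_mono) auto
      with False show ?thesis by (simp add: algebra_simps)
    qed
    then have "(1 + q) * K \<le> (1 + q) * ((A + 1) * \<bar>K - A\<bar>)"
      using q by (intro mult_left_mono) auto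
    then show ?thesis
      using 4 unfolding Z' by (simp add: m_def algebra_simps)
  qed
qed

section \<open>Resonant modes, kernel and solvability at the initial frequency\<close>

locale bifurcation =
  fixes q k0 :: nat
  assumes q: "q \<ge> 1" and k0: "k0 \<ge> 1"
begin

definition j0 :: int where "j0 = int q * (int k0)\<^sup>2 - 1"

definition \<kappa> :: real where "\<kappa> = 1 - 1 / ((real k0)\<^sup>2 * real q)"

definition \<omega>0 :: real where "\<omega>0 = omega0 q k0"

text \<open>On the modes p and \<open>flip p\<close> the operator at \<open>\<omega>0\<close> is the
  symmetric matrix with diagonal \<open>diag p\<close>, \<open>diag (flip p)\<close> and
  off-diagonal entry \<open>\<omega>0\<close>.\<close>

definition diag :: "int \<times> int \<Rightarrow> real" where
  "diag p = of_int (fst p) / real q + (of_int (snd p))\<^sup>2 + \<omega>0"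

text \<open>If the first index is 0, the two modes coincide and the determinant acquires the extra
  factor \<open>diag p - \<omega>0\<close>, which is k^2. It vanishes at the origin although the
  operator there is multiplication by \<open>2 * \<omega>0\<close>; hence the separate case p = 0 in
  the inverse.\<close>

definition det :: "int \<times> int \<Rightarrow> real" where
  "det p = diag p * diag (flip p) - \<omega>0\<^sup>2"

definition resonant :: "int \<times> int \<Rightarrow> bool" where
  "resonant p \<longleftrightarrow> \<bar>snd p\<bar> = int k0 \<and> \<bar>fst p\<bar> = j0"

text \<open>On the resonant modes the equation \<open>L(\<omega>\<^sub>0) y = f\<close> is solved with vanishing coefficient at
  \<open>(j\<^sub>0, \<plusminus>k\<^sub>0)\<close>.\<close>

definition inv_diag :: "int \<times> int \<Rightarrow> real" where
  "inv_diag p = (if resonant p then (if fst p = j0 then 0 else 1 / diag p)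
     else if p = 0 then 1 / (2 * \<omega>0) else diag (flip p) / det p)"

definition inv_off :: "int \<times> int \<Rightarrow> real" where
  "inv_off p = (if resonant p \<or> p = 0 then 0 else - \<omega>0 / det p)"

lemma real_q: "real q > 0" and real_k0: "real k0 > 0"
  using q k0 by auto

lemma k0_square: "(int k0)\<^sup>2 \<ge> 1" "(real k0)\<^sup>2 \<ge> 1"
  using k0 by (auto intro: one_le_power)

lemma j0_nonneg: "j0 \<ge> 0"
proof -
  have "1 * 1 \<le> int q * (int k0)\<^sup>2"
    using q k0_square by (intro mult_mono) auto
  then show ?thesis by (simp add: j0_def)
qed

lemma \<omega>0_eq: "\<omega>0 = - 1 / real q + 1 / (2 * (real k0)\<^sup>2 * (real q)\<^sup>2)"
  using real_q real_k0 by (simp add: \<omega>0_def omega0_def field_simps power2_eq_square)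

lemma \<omega>0_bounds: "\<omega>0 < 0" "\<bar>\<omega>0\<bar> \<le> 1"
proof -
  have "1 * 1 \<le> (real k0)\<^sup>2 * real q"
    using q k0_square by (intro mult_mono) auto
  then have a: "0 < 1 / (2 * (real k0)\<^sup>2 * real q)" "1 / (2 * (real k0)\<^sup>2 * real q) < 1"
    using real_q real_k0 by (auto simp: field_simps)
  define c where "c = 1 - 1 / (2 * (real k0)\<^sup>2 * real q)"
  have c: "0 < c" "c \<le> 1" using a by (auto simp: c_def)
  have w: "\<omega>0 = - (c / real q)"
    by (simp add: \<omega>0_def omega0_def c_def)
  show "\<omega>0 < 0" using c real_q by (simp add: w)
  have "c / real q \<le> 1 / 1" using c q by (intro frac_le) auto
  then show "\<bar>\<omega>0\<bar> \<le> 1" using c real_q by (simp add: w)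
qed

lemma diag_flip: "diag (flip p) = - (of_int (fst p) / real q) + (of_int (snd p))\<^sup>2 + \<omega>0"
  by (simp add: diag_def flip_def)

text \<open>The number 2 k0^2 q^2 \<open>\<omega>0\<close> is the integer 1 - 2 k0^2 q, so clearing
  denominators turns the absence of small divisors into a statement about integers.\<close>

lemma det_eq: "(real k0)\<^sup>2 * (real q)\<^sup>2 * det p =
    of_int ((int k0)\<^sup>2 * ((int q * (snd p)\<^sup>2 - 1)\<^sup>2 - \<bar>fst p\<bar>\<^sup>2) + (snd p)\<^sup>2 - (int k0)\<^sup>2)"
proof -
  define K where "K = (real_of_int (snd p))\<^sup>2"
  define J where "J = real_of_int (fst p) / real q"
  have w: "2 * (real k0)\<^sup>2 * (real q)\<^sup>2 * \<omega>0 = 1 - 2 * (real k0)\<^sup>2 * real q"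
    unfolding \<omega>0_eq using real_q real_k0 by (simp add: field_simps power2_eq_square)
  have det: "det p = K\<^sup>2 + 2 * \<omega>0 * K - J\<^sup>2"
    unfolding det_def diag_flip unfolding diag_def K_def [symmetric] J_def [symmetric]
    by (simp add: power2_eq_square algebra_simps)
  have "(real k0)\<^sup>2 * (real q)\<^sup>2 * det p = (real k0)\<^sup>2 * (real q)\<^sup>2 * K\<^sup>2
      + K * (2 * (real k0)\<^sup>2 * (real q)\<^sup>2 * \<omega>0) - (real k0)\<^sup>2 * (real q * J)\<^sup>2"
    unfolding det by (simp add: power_mult_distrib algebra_simps)
  also have "real q * J = of_int (fst p)"
    using real_q by (simp add: J_def)
  finally show ?thesis
    unfolding w by (simp add: K_def power2_eq_square algebra_simps)
qed

lemma resonant_flip [simp]: "resonant (flip p) = resonant p"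
  by (simp add: resonant_def flip_def)

lemma det_flip [simp]: "det (flip p) = det p"
  by (simp add: det_def mult.commute)

lemma det_bound:
  assumes "\<not> resonant p" "p \<noteq> 0"
  shows "of_int ((snd p)\<^sup>2 + \<bar>fst p\<bar>)
    \<le> (1 + real q) * ((real k0)\<^sup>2 + 1) * ((real k0)\<^sup>2 * (real q)\<^sup>2) * \<bar>det p\<bar>"
proof -
  have "\<not> ((snd p)\<^sup>2 = (int k0)\<^sup>2 \<and> \<bar>fst p\<bar> = int q * (int k0)\<^sup>2 - 1)"
    using assms(1) by (auto simp: resonant_def j0_def power2_eq_iff)
  moreover have "(snd p)\<^sup>2 \<noteq> 0 \<or> \<bar>fst p\<bar> \<noteq> 0"
    using assms(2) by (auto simp: prod_eq_iff)
  ultimately have "(snd p)\<^sup>2 + \<bar>fst p\<bar> \<le> (1 + int q) * ((int k0)\<^sup>2 + 1) *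
      \<bar>(int k0)\<^sup>2 * ((int q * (snd p)\<^sup>2 - 1)\<^sup>2 - \<bar>fst p\<bar>\<^sup>2) + (snd p)\<^sup>2 - (int k0)\<^sup>2\<bar>"
    using q k0_square by (intro determinant_lower_bound) auto
  then have "real_of_int ((snd p)\<^sup>2 + \<bar>fst p\<bar>) \<le> (1 + real q) * ((real k0)\<^sup>2 + 1) *
      \<bar>(real k0)\<^sup>2 * (real q)\<^sup>2 * det p\<bar>"
    unfolding det_eq of_int_abs [symmetric] by (subst (asm) of_int_le_iff [where 'a = real, symmetric]) simp
  then show ?thesis
    by (simp add: abs_mult mult.assoc)
qed

lemma det_nonzero: "\<not> resonant p \<Longrightarrow> p \<noteq> 0 \<Longrightarrow> det p \<noteq> 0"
proof
  assume a: "\<not> resonant p" "p \<noteq> 0" "det p = 0"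
  from det_bound [OF a(1,2)] have "real_of_int ((snd p)\<^sup>2 + \<bar>fst p\<bar>) \<le> 0"
    by (simp add: a)
  then have "(snd p)\<^sup>2 + \<bar>fst p\<bar> \<le> 0" by linarith
  then have "(snd p)\<^sup>2 = 0" "fst p = 0"
    by (smt (verit) zero_le_power2)+
  with a(2) show False by (simp add: prod_eq_iff)
qed

lemma coef_resonant:
  assumes "resonant p"
  shows "coef f p = coef f (fst p, int k0)" "diag p = diag (fst p, int k0)"
proof -
  have "snd p = int k0 \<or> snd p = - int k0"
    using assms by (auto simp: resonant_def)
  then show "coef f p = coef f (fst p, int k0)" "diag p = diag (fst p, int k0)"
    using coef_even [of f "fst p" "int k0"] by (cases p; auto simp: diag_def)+
qed

lemma inv_bounded: "\<exists>C. \<forall>p. \<bar>inv_diag p\<bar> \<le> C \<and> \<bar>inv_off p\<bar> \<le> C"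
proof -
  define B where "B = (1 + real q) * ((real k0)\<^sup>2 + 1) * ((real k0)\<^sup>2 * (real q)\<^sup>2)"
  \<comment> \<open>One summand per case of the inverse: nonresonant modes, the origin, and the
    resonant modes with first index \<open>- j0\<close>.\<close>
  define C where "C = 2 * B + 1 / (2 * \<bar>\<omega>0\<bar>) + 1 / \<bar>diag (- j0, int k0)\<bar>"
  have B: "B \<ge> 0" by (simp add: B_def)
  have "\<bar>inv_diag p\<bar> \<le> C \<and> \<bar>inv_off p\<bar> \<le> C" for p
  proof -
    have generic: "\<bar>x / det p\<bar> \<le> C" if p: "\<not> resonant p" "p \<noteq> 0"
      and x: "\<bar>x\<bar> \<le> of_int (\<bar>fst p\<bar>) + of_int ((snd p)\<^sup>2) + 1" for x
    proof -
      \<comment> \<open>Absorbs the constant 1 in the bound of the numerator; this is where the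
        factor 2 before \<open>B\<close> comes from.\<close>
      have "(snd p)\<^sup>2 + \<bar>fst p\<bar> \<ge> 1"
        using p(2) by (cases "snd p = 0") (auto simp: prod_eq_iff power2_eq_square, smt (verit) mult_eq_0_iff zero_le_square)
      then have "real_of_int ((snd p)\<^sup>2 + \<bar>fst p\<bar>) \<ge> 1" by linarith
      then have "\<bar>x\<bar> \<le> 2 * of_int ((snd p)\<^sup>2 + \<bar>fst p\<bar>)"
        using x by simp
      also have "\<dots> \<le> 2 * (B * \<bar>det p\<bar>)"
        unfolding B_def using det_bound [OF p] by (intro mult_left_mono) auto
      finally have "\<bar>x\<bar> / \<bar>det p\<bar> \<le> 2 * B"
        using det_nonzero [OF p] by (simp add: divide_le_eq mult.assoc)
      then show ?thesis
        by (simp add: C_def add_increasing2)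
    qed
    have d: "\<bar>diag (flip p)\<bar> \<le> of_int (\<bar>fst p\<bar>) + of_int ((snd p)\<^sup>2) + 1"
    proof -
      have "\<bar>of_int (fst p) / real q\<bar> \<le> of_int \<bar>fst p\<bar> / 1"
        unfolding abs_divide using q by (intro frac_le) auto
      then show ?thesis
        unfolding diag_flip using \<omega>0_bounds(2) zero_le_power2 [of "real_of_int (snd p)"]
        unfolding of_int_power by linarith
    qed
    have "diag p = diag (- j0, int k0)" if "resonant p" "fst p \<noteq> j0"
    proof -
      have "fst p = - j0" using that by (auto simp: resonant_def)
      then show ?thesis using coef_resonant(2) [OF that(1)] by simp
    qed
    then have "\<bar>inv_diag p\<bar> \<le> C"
      unfolding inv_diag_def using generic [OF _ _ d] B
      by (auto simp: C_def abs_mult)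
    moreover have "\<bar>inv_off p\<bar> \<le> C"
      unfolding inv_off_def using generic [of "- \<omega>0"] \<omega>0_bounds(2) B
      by (auto simp: C_def add_increasing)
    ultimately show ?thesis ..
  qed
  then show ?thesis by blast
qed

lemma inv_even: "inv_diag (j, - k) = inv_diag (j, k)" "inv_off (j, - k) = inv_off (j, k)"
proof -
  have "resonant (j, - k) = resonant (j, k)" "diag (j, - k) = diag (j, k)"
    "diag (flip (j, - k)) = diag (flip (j, k))" "((j, - k) = 0) = ((j, k) = 0)"
    by (auto simp: resonant_def diag_def flip_def zero_prod_def)
  then show "inv_diag (j, - k) = inv_diag (j, k)" "inv_off (j, - k) = inv_off (j, k)"
    by (simp_all add: inv_diag_def inv_off_def det_def)
qed

definition pinv :: "wiener \<Rightarrow> wiener" where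
  "pinv = matrix_multiplier inv_diag inv_off"

lemma coef_pinv: "coef (pinv f) p = inv_diag p * coef f p + inv_off p * coef f (flip p)"
proof -
  obtain C where "\<And>p. \<bar>inv_diag p\<bar> \<le> C" "\<And>p. \<bar>inv_off p\<bar> \<le> C"
    using inv_bounded by blast
  then show ?thesis
    unfolding pinv_def by (intro coef_matrix_multiplier inv_even)
qed

lemma bounded_linear_pinv: "bounded_linear pinv"
proof -
  obtain C where "\<And>p. \<bar>inv_diag p\<bar> \<le> C" "\<And>p. \<bar>inv_off p\<bar> \<le> C"
    using inv_bounded by blast
  then show ?thesis
    unfolding pinv_def by (intro bounded_linear_matrix_multiplier inv_even)
qed

text \<open>The pairing with the kernel vector of the resonant block, whose entries are in the ratio
  (1 - \<kappa>) : (1 + \<kappa>). The block is symmetric, so its range is the orthogonal complement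
  of its kernel.\<close>

definition solvability :: "wiener \<Rightarrow> real" where
  "solvability f = (1 - \<kappa>) * coef f (j0, int k0) + (1 + \<kappa>) * coef f (- j0, int k0)"

lemma bounded_linear_solvability: "bounded_linear solvability"
  unfolding solvability_def
  by (intro bounded_linear_add bounded_linear_const_mult bounded_linear_coef)

lemma \<kappa>_eq: "1 - \<kappa> = 1 / ((real k0)\<^sup>2 * real q)" "1 + \<kappa> = - \<omega>0 * 2 * real q"
  using real_q real_k0 by (simp_all add: \<kappa>_def \<omega>0_eq field_simps power2_eq_square)

text \<open>The product of the two values is \<open>\<omega>0\<^sup>2\<close>, so the resonant block
  is singular.\<close>

lemma diag_j0: "diag (- j0, int k0) = 1 / (2 * (real k0)\<^sup>2 * (real q)\<^sup>2)"
  "diag (j0, int k0) = 2 * (real k0)\<^sup>2 * (real q)\<^sup>2 * \<omega>0\<^sup>2"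
  unfolding diag_def j0_def \<omega>0_eq using real_q real_k0
  by (simp_all add: field_simps power2_eq_square)

text \<open>Off resonance this is Cramer's rule. A resonant block with \<open>j0\<close> nonzero has
  rank one: with the unknown at \<open>j0\<close> set to 0, the row of \<open>- j0\<close> fixes the
  unknown there, and the row of \<open>j0\<close> holds because of the solvability
  condition.\<close>

lemma pinv_solves:
  assumes "solvability f = 0"
  shows "diag p * coef (pinv f) p + \<omega>0 * coef (pinv f) (flip p) = coef f p"
proof (cases "resonant p")
  case False
  show ?thesis
  proof (cases "p = 0")
    case True
    then have "flip p = p" by (simp add: flip_def prod_eq_iff)
    then show ?thesis
      using True False \<omega>0_bounds(1) by (simp add: coef_pinv inv_diag_def inv_off_def diag_def)
  next
    case nz: False
    then have nz': "flip p \<noteq> 0" by (simp add: flip_def prod_eq_iff)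
    have "diag p * coef (pinv f) p + \<omega>0 * coef (pinv f) (flip p)
        = (diag p * diag (flip p) - \<omega>0\<^sup>2) * coef f p / det p"
      using False nz nz'
      by (simp add: coef_pinv inv_diag_def inv_off_def diff_divide_distrib add_divide_distrib
          algebra_simps power2_eq_square)
    also have "\<dots> = coef f p"
      unfolding det_def [symmetric] using det_nonzero [OF False nz] by simp
    finally show ?thesis .
  qed
next
  case True
  \<comment> \<open>The solvability condition rewritten as the row of \<open>j0\<close> after
    substituting the solution of the other row.\<close>
  have S: "coef f (j0, int k0) = \<omega>0 / diag (- j0, int k0) * coef f (- j0, int k0)"
    using assms real_q real_k0 unfolding solvability_def \<kappa>_eq diag_j0
    by (simp add: field_simps power2_eq_square)
  have f: "fst p = j0 \<or> fst p = - j0"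
    using True by (auto simp: resonant_def)
  have d: "diag (- j0, int k0) \<noteq> 0"
    using real_q real_k0 by (simp add: diag_j0)
  show ?thesis
  proof (cases "j0 = 0")
    \<comment> \<open>Here the two resonant modes coincide and the inverse is set to 0 on them;
      solvability makes the right-hand side vanish there as well.\<close>
    case 0: True
    then have p: "fst p = 0" using f by auto
    have "coef f (0, int k0) = 0"
      using assms 0 by (simp add: solvability_def algebra_simps)
    then have "coef f p = 0"
      using coef_resonant(1) [OF True, of f] p by simp
    moreover have "fst (flip p) = 0"
      using p by (simp add: flip_def)
    ultimately show ?thesis
      using True p 0 by (simp add: coef_pinv inv_diag_def inv_off_def)
  next
    case nz: False
    have p: "coef f p = coef f (fst p, int k0)" "coef f (flip p) = coef f (- fst p, int k0)"
      "diag p = diag (fst p, int k0)" "diag (flip p) = diag (- fst p, int k0)"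
      using coef_resonant(1) [OF True, of f] coef_resonant(1) [of "flip p" f]
        coef_resonant(2) [OF True] coef_resonant(2) [of "flip p"] True
      by (simp_all only: resonant_flip) (simp_all add: flip_def)
    show ?thesis
      using f
    proof
      assume f: "fst p = j0"
      then show ?thesis
        using True nz j0_nonneg S p f by (simp add: coef_pinv inv_diag_def inv_off_def) (simp add: flip_def)
    next
      assume f: "fst p = - j0"
      then show ?thesis
        using True nz j0_nonneg d p f by (simp add: coef_pinv inv_diag_def inv_off_def) (simp add: flip_def)
    qed
  qed
qed

text \<open>Normalisation of the correction: it does not change the coefficient at
  \<open>(j0, int k0)\<close>, so the parameter b can be read off from the solution.\<close>

lemma coef_pinv_j0: "coef (pinv f) (j0, int k0) = 0"
  using j0_nonneg by (simp add: coef_pinv inv_diag_def inv_off_def resonant_def)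

definition delta :: "int \<times> int \<Rightarrow> int \<times> int \<Rightarrow> real" where
  "delta r p = (if p = r then 1 else 0)"

lemma delta_has_sum:
  fixes h :: "int \<times> int \<Rightarrow> 'b::{real_normed_algebra_1, topological_semigroup_mult}"
  shows "((\<lambda>p. of_real (delta r p) * h p) has_sum h r) UNIV"
  by (rule has_sum_finite_neutralI [where B = "{r}"]) (auto simp: delta_def)

text \<open>Euler's formulas for (cos - i \<kappa> sin)(j0 t) times cos(k0 s). If \<open>j0\<close>
  is 0, the two groups of deltas fall on the same modes and add up, so the formula needs no case
  distinction.\<close>

lift_definition profile :: wiener is
  "\<lambda>p. (1 - \<kappa>) / 4 * (delta (j0, int k0) p + delta (j0, - int k0) p)
    + (1 + \<kappa>) / 4 * (delta (- j0, int k0) p + delta (- j0, - int k0) p)"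
proof safe
  let ?f = "\<lambda>p. (1 - \<kappa>) / 4 * (delta (j0, int k0) p + delta (j0, - int k0) p)
    + (1 + \<kappa>) / 4 * (delta (- j0, int k0) p + delta (- j0, - int k0) p)"
  show "?f (j, - k) = ?f (j, k)" for j k
    by (auto simp: delta_def)
  show "weighted ?f summable_on UNIV"
    by (rule finite_nonzero_values_imp_summable_on,
        rule finite_subset [where B = "{(j0, int k0), (j0, - int k0), (- j0, int k0), (- j0, - int k0)}"])
      (auto simp: weighted_def delta_def split: if_splits)
qed

lemma fourier_sum_profile: "fourier_sum profile = leading_profile q k0"
proof
  fix x :: "real \<times> real"
  obtain t s where x: "x = (t, s)" by (cases x)
  have "((\<lambda>p. ((1 - \<kappa>) / 4 * (of_real (delta (j0, int k0) p) * mode p x + of_real (delta (j0, - int k0) p) * mode p x)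
    + (1 + \<kappa>) / 4 * (of_real (delta (- j0, int k0) p) * mode p x + of_real (delta (- j0, - int k0) p) * mode p x)))
    has_sum ((1 - \<kappa>) / 4 * (mode (j0, int k0) x + mode (j0, - int k0) x)
      + (1 + \<kappa>) / 4 * (mode (- j0, int k0) x + mode (- j0, - int k0) x))) UNIV"
    by (intro has_sum_add has_sum_cmult_right delta_has_sum)
  then have "fourier_sum profile x = (1 - \<kappa>) / 4 * (mode (j0, int k0) x + mode (j0, - int k0) x)
      + (1 + \<kappa>) / 4 * (mode (- j0, int k0) x + mode (- j0, - int k0) x)"
    by (intro fourier_sum_eqI) (simp add: profile.rep_eq algebra_simps)
  also have "\<dots> = leading_profile q k0 x"
  proof -
    define \<alpha> \<beta> where "\<alpha> = of_int j0 * t" and "\<beta> = real k0 * s"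
    have "of_real ((1 - \<kappa>) / 4) * (cis (\<alpha> + \<beta>) + cis (\<alpha> - \<beta>)) + of_real ((1 + \<kappa>) / 4) * (cis (\<beta> - \<alpha>) + cis (- \<alpha> - \<beta>))
        = (of_real (cos \<alpha>) - \<i> * of_real (\<kappa> * sin \<alpha>)) * of_real (cos \<beta>)"
      by (simp add: complex_eq_iff cos_add cos_diff sin_add sin_diff field_simps)
    moreover have "real q * (real k0)\<^sup>2 - 1 = of_int j0"
      by (simp add: j0_def)
    ultimately show ?thesis
      unfolding leading_profile_def x \<kappa>_def [symmetric] mode_def
      by (simp add: \<alpha>_def \<beta>_def Let_def)
  qed
  finally show "fourier_sum profile x = leading_profile q k0 x" .
qed

lemma coef_profile_j0: "coef profile (j0, int k0) > 0"
proof -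
  have "1 - \<kappa> > 0" "1 + \<kappa> > 0"
    unfolding \<kappa>_eq using real_q real_k0 \<omega>0_bounds(1) by (auto simp: mult_neg_pos)
  then show ?thesis
    using k0 by (auto simp: profile.rep_eq delta_def field_simps)
qed

lemma coef_profile_nonresonant: "\<not> resonant p \<Longrightarrow> coef profile p = 0"
  using j0_nonneg by (cases p) (auto simp: profile.rep_eq delta_def resonant_def)

lemma profile_kernel: "diag p * coef profile p + \<omega>0 * coef profile (flip p) = 0"
proof (cases "resonant p")
  case False
  then show ?thesis
    by (simp add: coef_profile_nonresonant)
next
  case True
  have k0': "int k0 \<noteq> - int k0" using k0 by auto
  have j: "fst p = j0 \<or> fst p = - j0" using True by (auto simp: resonant_def)
  have "diag (fst p, int k0) * coef profile (fst p, int k0) + \<omega>0 * coef profile (- fst p, int k0) = 0"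
  proof (cases "j0 = 0")
    case 0: True
    then have "int q * (int k0)\<^sup>2 = 1" by (simp add: j0_def)
    then have c: "real q = 1" "(real k0)\<^sup>2 = 1"
      by (auto simp: zmult_eq_1_iff power2_eq_square)
    have "diag (0, int k0) = - \<omega>0"
      unfolding diag_def \<omega>0_eq fst_conv snd_conv of_int_of_nat_eq c by simp
    then show ?thesis
      using j 0 by simp
  next
    case nz: False
    have c: "coef profile (j0, int k0) = (1 - \<kappa>) / 4" "coef profile (- j0, int k0) = (1 + \<kappa>) / 4"
      using nz k0' by (auto simp: profile.rep_eq delta_def)
    from j show ?thesis
    proof
      assume "fst p = j0"
      then show ?thesis
        using real_q real_k0 unfolding \<open>fst p = j0\<close> c diag_j0 \<kappa>_eq by (simp add: field_simps power2_eq_square)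
    next
      assume "fst p = - j0"
      then show ?thesis
        using real_q real_k0 unfolding \<open>fst p = - j0\<close> minus_minus c diag_j0 \<kappa>_eq
        by (simp add: field_simps power2_eq_square)
    qed
  qed
  then show ?thesis
    using coef_resonant(1) [OF True, of profile] coef_resonant(1) [of "flip p" profile]
      coef_resonant(2) [OF True] True
    by (simp only: resonant_flip) (simp add: flip_def)
qed

text \<open>The transversality condition: the derivative of L(\<omega>) in \<omega>, applied to the
  kernel vector, leaves the range. The value is the coefficient of \<open>m\<close> in the equation
  that determines it.\<close>

lemma solvability_profile: "solvability (profile + time_reverse profile) > 0"
proof -
  have k0': "int k0 \<noteq> - int k0" using k0 by auto
  show ?thesis
    using k0' by (cases "j0 = 0") (auto simp: solvability_def flip_def profile.rep_eq delta_def field_simps)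
qed

text \<open>Two second indices equal to +-k0 add up to 0 or +-2 k0, never to k0.\<close>

lemma solvability_profile_square: "solvability (conv (time_reverse profile) (time_reverse profile)) = 0"
proof -
  have "coef (conv (time_reverse profile) (time_reverse profile)) (j, int k0) = 0" for j
  proof -
    have "coef (time_reverse profile) r * coef (time_reverse profile) ((j, int k0) - r) = 0" for r
      using k0 by (cases r) (auto simp: profile.rep_eq delta_def flip_def)
    then show ?thesis by (simp only: coef_conv infsum_0_simp)
  qed
  then show ?thesis by (simp add: solvability_def)
qed

end

section \<open>The reduced system\<close>

text \<open>The form of regularity shared by polynomial maps: it is stable under bounded bilinear
  maps, which a global Lipschitz condition is not.\<close>

definition lipschitz_on_bounded :: "('a::metric_space \<Rightarrow> 'b::metric_space) \<Rightarrow> bool" where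
  "lipschitz_on_bounded f \<longleftrightarrow> (\<forall>S. bounded S \<longrightarrow> (\<exists>L. L-lipschitz_on S f))"

lemma lipschitz_on_bounded_const: "lipschitz_on_bounded (\<lambda>x. c)"
  unfolding lipschitz_on_bounded_def using lipschitz_on_constant by blast

lemma lipschitz_on_bounded_ident: "lipschitz_on_bounded (\<lambda>x. x)"
  unfolding lipschitz_on_bounded_def using lipschitz_on_id by blast

lemma lipschitz_on_bounded_add:
  fixes f g :: "'a::metric_space \<Rightarrow> 'b::real_normed_vector"
  shows "lipschitz_on_bounded f \<Longrightarrow> lipschitz_on_bounded g \<Longrightarrow> lipschitz_on_bounded (\<lambda>x. f x + g x)"
  unfolding lipschitz_on_bounded_def by (fast intro: lipschitz_on_add)

lemma lipschitz_on_bounded_Pair: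
  "lipschitz_on_bounded f \<Longrightarrow> lipschitz_on_bounded g \<Longrightarrow> lipschitz_on_bounded (\<lambda>x. (f x, g x))"
  unfolding lipschitz_on_bounded_def by (fast intro: lipschitz_on_Pair)

lemma lipschitz_on_bounded_linear:
  assumes h: "bounded_linear h" and f: "lipschitz_on_bounded f"
  shows "lipschitz_on_bounded (\<lambda>x. h (f x))"
  unfolding lipschitz_on_bounded_def
proof (intro allI impI)
  fix S :: "'c set" assume "bounded S"
  then obtain L where L: "L-lipschitz_on S f"
    using f unfolding lipschitz_on_bounded_def by blast
  obtain B where "B \<ge> 0" and B: "\<And>x. norm (h x) \<le> norm x * B"
    using bounded_linear.nonneg_bounded [OF h] by blast
  have "B-lipschitz_on (f ` S) h"
    by (rule lipschitz_onI) (use B \<open>B \<ge> 0\<close> in \<open>auto simp: dist_norm mult.commute linear_diff [OF bounded_linear.linear [OF h], symmetric]\<close>)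
  with L show "\<exists>L. L-lipschitz_on S (\<lambda>x. h (f x))"
    using lipschitz_on_compose2 by blast
qed

lemma lipschitz_on_bounded_image:
  assumes "L-lipschitz_on S f" "bounded S"
  shows "bounded (f ` S)"
proof (cases "S = {}")
  case False
  then obtain a where a: "a \<in> S" by blast
  obtain e where e: "\<And>y. y \<in> S \<Longrightarrow> dist a y \<le> e"
    using assms(2) bounded_any_center [of S a] by auto
  have "dist (f a) (f y) \<le> L * e" if "y \<in> S" for y
    using lipschitz_onD [OF assms(1) a that] mult_left_mono [OF e [OF that] lipschitz_on_nonneg [OF assms(1)]]
    by linarith
  then show ?thesis
    unfolding bounded_def by blast
qed simp

lemma lipschitz_on_bounded_bilinear:
  assumes h: "bounded_bilinear h" and f: "lipschitz_on_bounded f" and g: "lipschitz_on_bounded g"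
  shows "lipschitz_on_bounded (\<lambda>x. h (f x) (g x))"
  unfolding lipschitz_on_bounded_def
proof (intro allI impI)
  interpret bounded_bilinear h by (fact h)
  fix S :: "'d set" assume S: "bounded S"
  obtain L M where L: "L-lipschitz_on S f" and M: "M-lipschitz_on S g"
    using f g S unfolding lipschitz_on_bounded_def by blast
  obtain A where A: "\<And>x. x \<in> S \<Longrightarrow> norm (f x) \<le> A" "A > 0"
    using lipschitz_on_bounded_image [OF L S] by (auto simp: bounded_pos)
  obtain B where B: "\<And>x. x \<in> S \<Longrightarrow> norm (g x) \<le> B" "B > 0"
    using lipschitz_on_bounded_image [OF M S] by (auto simp: bounded_pos)
  obtain K where K: "K \<ge> 0" "\<And>a b. norm (h a b) \<le> norm a * norm b * K"
    using nonneg_bounded by blast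
  have nn: "L \<ge> 0" "M \<ge> 0" using L M lipschitz_on_nonneg by auto
  have "((A * M + L * B) * K)-lipschitz_on S (\<lambda>x. h (f x) (g x))"
  proof (rule lipschitz_onI)
    fix x y assume xy: "x \<in> S" "y \<in> S"
    have "norm (h (f x) (g x) - h (f y) (g y)) = norm (h (f x) (g x - g y) + h (f x - f y) (g y))"
      by (simp add: diff_left diff_right)
    also have "\<dots> \<le> norm (f x) * norm (g x - g y) * K + norm (f x - f y) * norm (g y) * K"
      by (rule norm_triangle_le [OF add_mono [OF K(2) K(2)]])
    also have "\<dots> \<le> A * (M * dist x y) * K + (L * dist x y) * B * K"
      using lipschitz_onD [OF L xy] lipschitz_onD [OF M xy] A B K nn xy
      by (intro add_mono mult_right_mono mult_mono) (auto simp: dist_norm)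
    finally show "dist (h (f x) (g x)) (h (f y) (g y)) \<le> (A * M + L * B) * K * dist x y"
      by (simp add: dist_norm algebra_simps)
  qed (use A B K nn in auto)
  then show "\<exists>L. L-lipschitz_on S (\<lambda>x. h (f x) (g x))" by blast
qed

lemma lipschitz_on_bounded_diff:
  fixes f g :: "'a::metric_space \<Rightarrow> 'b::real_normed_vector"
  shows "lipschitz_on_bounded f \<Longrightarrow> lipschitz_on_bounded g \<Longrightarrow> lipschitz_on_bounded (\<lambda>x. f x - g x)"
  unfolding lipschitz_on_bounded_def by (fast intro: lipschitz_on_diff)

lemma lipschitz_on_bounded_minus:
  fixes f :: "'a::metric_space \<Rightarrow> 'b::real_normed_vector"
  shows "lipschitz_on_bounded f \<Longrightarrow> lipschitz_on_bounded (\<lambda>x. - f x)"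
  unfolding lipschitz_on_bounded_def by (fast intro: lipschitz_on_minus)

lemmas lipschitz_on_bounded_intros =
  lipschitz_on_bounded_const lipschitz_on_bounded_ident lipschitz_on_bounded_add
  lipschitz_on_bounded_diff lipschitz_on_bounded_minus lipschitz_on_bounded_Pair
  lipschitz_on_bounded_linear [OF bounded_linear_fst] lipschitz_on_bounded_linear [OF bounded_linear_snd]
  lipschitz_on_bounded_bilinear [OF bounded_bilinear_scaleR]
  lipschitz_on_bounded_bilinear [OF bounded_bilinear_mult]
  lipschitz_on_bounded_bilinear [OF bounded_bilinear_conv]
  lipschitz_on_bounded_linear [OF bounded_linear_time_reverse]

text \<open>On a fixed ball the term with factor b costs at most 1/4 of contraction for small b. The
  Lipschitz dependence of the fixed point on b supplies the continuity of the branch.\<close>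

lemma perturbed_contraction_fixpoint:
  fixes T :: "'a::banach \<Rightarrow> 'a" and R :: "real \<times> 'a \<Rightarrow> 'a"
  assumes T: "(1/2)-lipschitz_on UNIV T" and R: "lipschitz_on_bounded R"
  obtains b0 r L x where "0 < b0" "b0 \<le> 1" "L-lipschitz_on {0..b0} x"
    and "\<And>b. b \<in> {0..b0} \<Longrightarrow> norm (x b) \<le> r"
    and "\<And>b. b \<in> {0..b0} \<Longrightarrow> T (x b) + b *\<^sub>R R (b, x b) = x b"
proof -
  define N where "N = norm (T 0)"
  \<comment> \<open>\<open>T\<close> maps the ball of this radius into the one of radius N + r/2 = r
    - 1, leaving room for the perturbation.\<close>
  define r where "r = 2 * N + 2"
  have N: "N \<ge> 0" and r: "r \<ge> 0" by (auto simp: N_def r_def)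
  define S where "S = {0..1::real} \<times> cball (0::'a) r"
  have S: "bounded S" by (simp add: S_def bounded_Times)
  then obtain L where L: "L-lipschitz_on S R"
    using R unfolding lipschitz_on_bounded_def by blast
  then have L0: "L \<ge> 0" by (rule lipschitz_on_nonneg)
  obtain M where M0: "M > 0" and M: "\<And>z. z \<in> S \<Longrightarrow> norm (R z) \<le> M"
    using lipschitz_on_bounded_image [OF L S] by (auto simp: bounded_pos)
  define b0 where "b0 = min 1 (1 / (4 * (L + M)))"
  have b0: "0 < b0" "b0 \<le> 1" using L0 M0 by (auto simp: b0_def)
  have small: "b * L \<le> 1 / 4" "b * M \<le> 1 / 4" if "b \<in> {0..b0}" for b
  proof -
    have "b * (L + M) \<le> 1 / (4 * (L + M)) * (L + M)"
      using that L0 M0 by (intro mult_right_mono) (auto simp: b0_def)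
    also have "\<dots> = 1 / 4" using L0 M0 by simp
    finally have "b * L + b * M \<le> 1 / 4"
      by (simp only: ring_distribs)
    moreover have "0 \<le> b * L" "0 \<le> b * M"
      using that L0 M0 by auto
    ultimately show "b * L \<le> 1 / 4" "b * M \<le> 1 / 4"
      by linarith+
  qed
  define F where "F b y = T y + b *\<^sub>R R (b, y)" for b y
  have TT: "norm (T y - T y') \<le> 1 / 2 * norm (y - y')" for y y'
    using lipschitz_on_normD [OF T, of y y'] by simp
  have RR: "norm (R (b, y) - R (b', y')) \<le> L * (\<bar>b - b'\<bar> + norm (y - y'))"
    if "b \<in> {0..b0}" "b' \<in> {0..b0}" "y \<in> cball 0 r" "y' \<in> cball 0 r" for b b' y y'
  proof -
    have "norm (R (b, y) - R (b', y')) \<le> L * norm ((b, y) - (b', y'))"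
      using that b0 by (intro lipschitz_on_normD [OF L]) (auto simp: S_def)
    also have "\<dots> \<le> L * (\<bar>b - b'\<bar> + norm (y - y'))"
      using norm_Pair_le [of "b - b'" "y - y'"] L0 by (intro mult_left_mono) auto
    finally show ?thesis .
  qed
  \<comment> \<open>Taken with two parameters so that it serves twice: b = b' gives the contraction
    for Banach's theorem, distinct values the dependence of the fixed point on b.\<close>
  have contr: "norm (F b y - F b' y') \<le> 3 / 4 * norm (y - y') + (L + M) * \<bar>b - b'\<bar>"
    if b: "b \<in> {0..b0}" "b' \<in> {0..b0}" and y: "y \<in> cball 0 r" "y' \<in> cball 0 r" for b b' y y'
  proof -
    have "F b y - F b' y' = (T y - T y') + (b *\<^sub>R (R (b, y) - R (b', y')) + (b - b') *\<^sub>R R (b', y'))"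
      by (simp add: F_def algebra_simps)
    then have "norm (F b y - F b' y') \<le> norm (T y - T y')
        + (norm (b *\<^sub>R (R (b, y) - R (b', y'))) + norm ((b - b') *\<^sub>R R (b', y')))"
      by (simp only: order_trans [OF norm_triangle_ineq add_left_mono [OF norm_triangle_ineq]])
    also have "norm (b *\<^sub>R (R (b, y) - R (b', y'))) \<le> b * (L * (\<bar>b - b'\<bar> + norm (y - y')))"
      using b RR [OF b y] by (simp add: mult_left_mono)
    also have "b * (L * (\<bar>b - b'\<bar> + norm (y - y'))) = b * L * norm (y - y') + b * (L * \<bar>b - b'\<bar>)"
      by (simp add: algebra_simps)
    also have "b * L * norm (y - y') \<le> 1 / 4 * norm (y - y')"
      by (intro mult_right_mono small b) simp
    also have "b * (L * \<bar>b - b'\<bar>) \<le> L * \<bar>b - b'\<bar>"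
      using b b0 L0 by (intro mult_left_le_one_le) auto
    also have "norm ((b - b') *\<^sub>R R (b', y')) \<le> M * \<bar>b - b'\<bar>"
      using M [of "(b', y')"] b y b0 by (simp add: S_def mult.commute [of M] mult_left_mono)
    finally show ?thesis
      using TT [of y y'] by (simp add: algebra_simps)
  qed
  have self: "F b y \<in> cball 0 r" if b: "b \<in> {0..b0}" and y: "y \<in> cball 0 r" for b y
  proof -
    have "norm (T y) \<le> N + r / 2"
      using TT [of y 0] y norm_triangle_sub [of "T y" "T 0"] by (simp add: N_def)
    moreover have "norm (b *\<^sub>R R (b, y)) \<le> b * M"
      using M [of "(b, y)"] b y b0 by (simp add: S_def mult_left_mono)
    ultimately have "norm (F b y) \<le> N + r / 2 + 1 / 4"
      using norm_triangle_ineq [of "T y" "b *\<^sub>R R (b, y)"] small(2) [OF b] by (simp add: F_def)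
    then have "norm (F b y) \<le> r"
      unfolding r_def by argo
    then show ?thesis by simp
  qed
  have "\<exists>y\<in>cball 0 r. F b y = y" if b: "b \<in> {0..b0}" for b
  proof -
    have "\<exists>!y\<in>cball 0 r. F b y = y"
      by (rule Banach_fix [where c = "3/4"])
        (use r self [OF b] contr [OF b b] in \<open>auto simp: complete_eq_closed dist_norm\<close>)
    then show ?thesis by blast
  qed
  then obtain x where x: "\<And>b. b \<in> {0..b0} \<Longrightarrow> x b \<in> cball 0 r \<and> F b (x b) = x b"
    by metis
  \<comment> \<open>At two fixed points the 3/4 term is absorbed on the left, and division by the
    remaining 1/4 produces the factor 4.\<close>
  have "(4 * (L + M))-lipschitz_on {0..b0} x"
  proof (rule lipschitz_onI)
    fix b b' assume b: "b \<in> {0..b0}" "b' \<in> {0..b0}"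
    show "dist (x b) (x b') \<le> 4 * (L + M) * dist b b'"
      using contr [OF b, of "x b" "x b'"] x [OF b(1)] x [OF b(2)] by (simp add: dist_norm algebra_simps)
  qed (use L0 M0 in simp)
  with b0 x show ?thesis
    by (intro that [of b0 "4 * (L + M)" x r]) (auto simp: F_def)
qed


context bifurcation
begin

abbreviation cprofile :: wiener where
  "cprofile \<equiv> time_reverse profile"

abbreviation square :: wiener where
  "square \<equiv> conv cprofile cprofile"

text \<open>Inserting the ansatz removes the profile, which lies in the kernel; division by b^2
  leaves L applied to Y, at the initial frequency, equal to minus this element. The terms with
  \<open>m\<close> outside the first summand come from the shift of the frequency.\<close>

definition residual :: "real \<Rightarrow> wiener \<times> wiener \<times> real \<Rightarrow> wiener" where
  "residual b = (\<lambda>(Y, V, m). (\<omega>0 + b\<^sup>2 * m) *\<^sub>R square +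
     b *\<^sub>R (m *\<^sub>R (profile + cprofile + b *\<^sub>R (Y + time_reverse Y)) + V))"

text \<open>The equation for \<open>V\<close> is the polynomial form of the nonlinearity: the
  leading squares cancel and the rest is divided by b^3.\<close>

definition reduced_solution :: "real \<Rightarrow> wiener \<times> wiener \<times> real \<Rightarrow> bool" where
  "reduced_solution b = (\<lambda>(Y, V, m).
     Y = - pinv (residual b (Y, V, m)) \<and>
     V = (2 * (\<omega>0 + b\<^sup>2 * m)) *\<^sub>R conv cprofile (time_reverse Y)
       + (b * (\<omega>0 + b\<^sup>2 * m)) *\<^sub>R conv (time_reverse Y) (time_reverse Y)
       - conv (cprofile + b *\<^sub>R time_reverse Y) ((\<omega>0 + b\<^sup>2 * m) *\<^sub>R square + b *\<^sub>R V) \<and>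
     solvability (residual b (Y, V, m)) = 0)"

text \<open>At \<open>b = 0\<close> the system is triangular: \<open>Y\<close> is explicit, \<open>V\<close> depends on \<open>Y\<close> and \<open>m\<close> on \<open>V\<close>. Measuring
  \<open>V\<close> in units of \<open>K\<close> and \<open>m\<close> in units of \<open>K\<^sup>2\<close> turns the triangular part into a contraction.\<close>

lemma reduced_solution_branch:
  obtains b0 r L Y V m where "0 < b0" "b0 \<le> 1" "L-lipschitz_on {0..b0} Y" "L-lipschitz_on {0..b0} m"
    and "\<And>b. b \<in> {0..b0} \<Longrightarrow> norm (Y b) \<le> r \<and> \<bar>m b\<bar> \<le> r"
    and "\<And>b. b \<in> {0..b0} \<Longrightarrow> reduced_solution b (Y b, V b, m b)"
proof -
  interpret conv: bounded_bilinear conv by (rule bounded_bilinear_conv)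
  interpret tr: bounded_linear time_reverse by (rule bounded_linear_time_reverse)
  interpret pinv: bounded_linear pinv by (rule bounded_linear_pinv)
  interpret P: bounded_linear solvability by (rule bounded_linear_solvability)
  define P0 where "P0 = solvability (profile + cprofile)"
  have P0: "P0 > 0" unfolding P0_def by (rule solvability_profile)
  obtain B where B: "B \<ge> 0" "\<And>f. norm (solvability f) \<le> norm f * B"
    using P.nonneg_bounded by blast
  \<comment> \<open>Lipschitz constants of the unscaled triangular part: \<open>c1\<close> for V as
    a function of Y, \<open>c2\<close> for m as a function of V. The choice of \<open>K\<close>
    makes (c1 + c2)/K at most 1/2.\<close>
  define c1 c2 where "c1 = 2 * \<bar>\<omega>0\<bar> * norm cprofile" and "c2 = B / P0"
  define K where "K = 2 * (c1 + c2) + 1"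
  have c: "c1 \<ge> 0" "c2 \<ge> 0" using B P0 by (auto simp: c1_def c2_def)
  then have K: "K > 0" "K \<noteq> 0" by (auto simp: K_def)
  define T :: "wiener \<times> wiener \<times> real \<Rightarrow> wiener \<times> wiener \<times> real" where
    "T = (\<lambda>(Y, V, m). (- \<omega>0 *\<^sub>R pinv square,
       (1 / K) *\<^sub>R ((2 * \<omega>0) *\<^sub>R conv cprofile (time_reverse Y) - \<omega>0 *\<^sub>R conv cprofile square),
       - (solvability V / (P0 * K))))"
  \<comment> \<open>All terms of positive order in b, divided by b. The local \<open>V\<close> and
    \<open>m\<close> undo the scaling of the fixed-point variables.\<close>
  define R :: "real \<times> wiener \<times> wiener \<times> real \<Rightarrow> wiener \<times> wiener \<times> real" where
    "R z = (let b = fst z; Y = fst (snd z); V = K *\<^sub>R fst (snd (snd z)); m = K\<^sup>2 * snd (snd (snd z));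
         Z = time_reverse Y in
       (- pinv (m *\<^sub>R (profile + cprofile + b *\<^sub>R (Y + Z)) + V + (b * m) *\<^sub>R square),
        (1 / K) *\<^sub>R ((2 * (b * m)) *\<^sub>R conv cprofile Z + (\<omega>0 + b * b * m) *\<^sub>R conv Z Z - conv cprofile V
          - conv Z ((\<omega>0 + b * b * m) *\<^sub>R square + b *\<^sub>R V) - (b * m) *\<^sub>R conv cprofile square),
        - (m * solvability (Y + Z) * (1 / (P0 * K\<^sup>2)))))" for z
  have "(1/2)-lipschitz_on UNIV T"
  proof (rule lipschitz_onI)
    fix x y :: "wiener \<times> wiener \<times> real"
    obtain Y V m where x: "x = (Y, V, m)" by (cases x) auto
    obtain Y' V' m' where y: "y = (Y', V', m')" by (cases y) auto
    have le: "norm (Y - Y') \<le> norm (x - y)" "norm (V - V') \<le> norm (x - y)"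
      using norm_fst_le [of "Y - Y'" "(V - V', m - m')"] norm_snd_le [of "(V - V', m - m')" "Y - Y'"]
        norm_fst_le [of "V - V'" "m - m'"]
      by (auto simp: x y)
    have "T x - T y = (0, (2 * \<omega>0 / K) *\<^sub>R conv cprofile (time_reverse (Y - Y')), - (solvability (V - V') / (P0 * K)))"
      by (simp add: T_def x y tr.diff P.diff conv.diff_right algebra_simps diff_divide_distrib)
    then have "norm (T x - T y) \<le> norm ((2 * \<omega>0 / K) *\<^sub>R conv cprofile (time_reverse (Y - Y')))
        + norm (solvability (V - V') / (P0 * K))"
      using norm_Pair_le [of "(2 * \<omega>0 / K) *\<^sub>R conv cprofile (time_reverse (Y - Y'))" "- (solvability (V - V') / (P0 * K))"]
      by (simp add: norm_Pair)
    also have "norm ((2 * \<omega>0 / K) *\<^sub>R conv cprofile (time_reverse (Y - Y'))) \<le> c1 / K * norm (x - y)"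
    proof -
      have "norm (conv cprofile (time_reverse (Y - Y'))) \<le> norm cprofile * norm (x - y)"
        using norm_conv_le [of cprofile "time_reverse (Y - Y')"] le(1)
          mult_left_mono [OF le(1), of "norm cprofile"] by simp
      then have "\<bar>2 * \<omega>0 / K\<bar> * norm (conv cprofile (time_reverse (Y - Y'))) \<le> \<bar>2 * \<omega>0 / K\<bar> * (norm cprofile * norm (x - y))"
        by (rule mult_left_mono) simp
      then show ?thesis
        using K by (simp add: c1_def abs_mult mult.assoc)
    qed
    also have "norm (solvability (V - V') / (P0 * K)) \<le> c2 / K * norm (x - y)"
    proof -
      have "norm (solvability (V - V')) \<le> norm (x - y) * B"
        using B(2) [of "V - V'"] mult_right_mono [OF le(2) B(1)] by linarith
      then have "norm (solvability (V - V')) / (P0 * K) \<le> norm (x - y) * B / (P0 * K)"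
        using P0 K by (intro divide_right_mono) auto
      then show ?thesis
        using P0 K by (simp add: c2_def abs_mult mult_ac)
    qed
    also have "c1 / K * norm (x - y) + c2 / K * norm (x - y) = (c1 + c2) / K * norm (x - y)"
      by (simp add: add_divide_distrib algebra_simps)
    also have "\<dots> \<le> 1 / 2 * norm (x - y)"
      using c by (intro mult_right_mono) (auto simp: K_def field_simps)
    finally show "dist (T x) (T y) \<le> 1 / 2 * dist x y"
      by (simp add: dist_norm)
  qed simp
  moreover have "lipschitz_on_bounded R"
    unfolding R_def Let_def
    by (intro lipschitz_on_bounded_intros lipschitz_on_bounded_linear [OF bounded_linear_pinv]
        lipschitz_on_bounded_linear [OF bounded_linear_solvability])
  ultimately obtain b0 r L x where b0: "0 < b0" "b0 \<le> 1" and L: "L-lipschitz_on {0..b0} x"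
    and r: "\<And>b. b \<in> {0..b0} \<Longrightarrow> norm (x b) \<le> r"
    and fp: "\<And>b. b \<in> {0..b0} \<Longrightarrow> T (x b) + b *\<^sub>R R (b, x b) = x b"
    using perturbed_contraction_fixpoint [of T R] by metis
  define Y V m where "Y b = fst (x b)" and "V b = K *\<^sub>R fst (snd (x b))" and "m b = K\<^sup>2 * snd (snd (x b))" for b
  have x: "x b = (Y b, (1 / K) *\<^sub>R V b, m b / K\<^sup>2)" for b
    using K by (simp add: Y_def V_def m_def)
  have sol: "reduced_solution b (Y b, V b, m b)" if b: "b \<in> {0..b0}" for b
  proof -
    let ?Z = "time_reverse (Y b)"
    note fx = fp [OF b, unfolded x T_def R_def Let_def]
    from fx have Y: "Y b = - \<omega>0 *\<^sub>R pinv square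
        + b *\<^sub>R - pinv (m b *\<^sub>R (profile + cprofile + b *\<^sub>R (Y b + ?Z)) + V b + (b * m b) *\<^sub>R square)"
      using K by simp
    from fx have "(1 / K) *\<^sub>R V b = (1 / K) *\<^sub>R ((2 * \<omega>0) *\<^sub>R conv cprofile ?Z - \<omega>0 *\<^sub>R conv cprofile square)
        + b *\<^sub>R (1 / K) *\<^sub>R ((2 * (b * m b)) *\<^sub>R conv cprofile ?Z + (\<omega>0 + b * b * m b) *\<^sub>R conv ?Z ?Z - conv cprofile (V b)
          - conv ?Z ((\<omega>0 + b * b * m b) *\<^sub>R square + b *\<^sub>R V b) - (b * m b) *\<^sub>R conv cprofile square)"
      using K by simp
    then have "(1 / K) *\<^sub>R V b = (1 / K) *\<^sub>R ((2 * \<omega>0) *\<^sub>R conv cprofile ?Z - \<omega>0 *\<^sub>R conv cprofile square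
        + b *\<^sub>R ((2 * (b * m b)) *\<^sub>R conv cprofile ?Z + (\<omega>0 + b * b * m b) *\<^sub>R conv ?Z ?Z - conv cprofile (V b)
          - conv ?Z ((\<omega>0 + b * b * m b) *\<^sub>R square + b *\<^sub>R V b) - (b * m b) *\<^sub>R conv cprofile square))"
      by (simp only: scaleR_add_right scaleR_left_commute [of b "1 / K"])
    then have V: "V b = (2 * \<omega>0) *\<^sub>R conv cprofile ?Z - \<omega>0 *\<^sub>R conv cprofile square
        + b *\<^sub>R ((2 * (b * m b)) *\<^sub>R conv cprofile ?Z + (\<omega>0 + b * b * m b) *\<^sub>R conv ?Z ?Z - conv cprofile (V b)
          - conv ?Z ((\<omega>0 + b * b * m b) *\<^sub>R square + b *\<^sub>R V b) - (b * m b) *\<^sub>R conv cprofile square)"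
      using K by (simp only: scaleR_cancel_left) simp
    from fx have "m b / K\<^sup>2 = - (solvability ((1 / K) *\<^sub>R V b) / (P0 * K))
        + b *\<^sub>R - (m b * solvability (Y b + ?Z) * (1 / (P0 * K\<^sup>2)))"
      using K by simp
    \<comment> \<open>The solvability condition after cancelling a factor b. It is imposed at b = 0
      too, where the uncancelled condition holds automatically and would leave \<open>m\<close>
      undetermined.\<close>
    then have m: "m b * P0 + solvability (V b) + b * (m b * solvability (Y b + ?Z)) = 0"
      using K P0 by (simp add: P.scaleR field_simps power2_eq_square)
    have "Y b = - pinv (residual b (Y b, V b, m b))"
      by (subst Y) (simp add: residual_def pinv.add pinv.scaleR algebra_simps power2_eq_square)
    moreover have "V b = (2 * (\<omega>0 + b\<^sup>2 * m b)) *\<^sub>R conv cprofile ?Z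
       + (b * (\<omega>0 + b\<^sup>2 * m b)) *\<^sub>R conv ?Z ?Z
       - conv (cprofile + b *\<^sub>R ?Z) ((\<omega>0 + b\<^sup>2 * m b) *\<^sub>R square + b *\<^sub>R V b)"
      by (subst V) (simp add: conv.add_left conv.add_right conv.scaleR_left conv.scaleR_right
          algebra_simps power2_eq_square)
    moreover have "solvability (residual b (Y b, V b, m b)) = 0"
    proof -
      have "solvability (residual b (Y b, V b, m b))
          = (\<omega>0 + b\<^sup>2 * m b) * solvability square
            + b * (m b * P0 + solvability (V b) + b * (m b * solvability (Y b + ?Z)))"
        by (simp add: residual_def P.add P.scaleR P0_def algebra_simps)
      then show ?thesis
        unfolding m solvability_profile_square by simp
    qed
    ultimately show ?thesis
      by (simp add: reduced_solution_def)
  qed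
  have bound: "norm (Y b) \<le> max 1 (K\<^sup>2) * r \<and> \<bar>m b\<bar> \<le> max 1 (K\<^sup>2) * r" if "b \<in> {0..b0}" for b
  proof -
    have "norm (Y b) \<le> norm (x b)" "\<bar>snd (snd (x b))\<bar> \<le> norm (x b)"
      using norm_fst_le [of "fst (x b)" "snd (x b)"] norm_snd_le [of "snd (x b)" "fst (x b)"]
        norm_snd_le [of "snd (snd (x b))" "fst (snd (x b))"] by (auto simp: Y_def)
    then have "1 * norm (Y b) \<le> max 1 (K\<^sup>2) * r" "K\<^sup>2 * \<bar>snd (snd (x b))\<bar> \<le> max 1 (K\<^sup>2) * r"
      using r [OF that] by (intro mult_mono; fastforce)+
    then show ?thesis by (simp add: m_def abs_mult)
  qed
  have "1-lipschitz_on (x ` {0..b0}) fst"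
    by (rule lipschitz_onI) (auto simp: dist_fst_le)
  then have LY: "(1 * L)-lipschitz_on {0..b0} Y"
    unfolding Y_def [abs_def] by (rule lipschitz_on_compose2 [OF L])
  have "(K\<^sup>2)-lipschitz_on (x ` {0..b0}) (\<lambda>z. K\<^sup>2 * snd (snd z))"
  proof (rule lipschitz_onI)
    fix y z assume "y \<in> x ` {0..b0}" "z \<in> x ` {0..b0}"
    have "dist (snd (snd y)) (snd (snd z)) \<le> dist y z"
      by (rule order_trans [OF dist_snd_le dist_snd_le])
    then show "dist (K\<^sup>2 * snd (snd y)) (K\<^sup>2 * snd (snd z)) \<le> K\<^sup>2 * dist y z"
      by (simp add: dist_real_def right_diff_distrib [symmetric] abs_mult mult_left_mono)
  qed simp
  then have Lm: "(K\<^sup>2 * L)-lipschitz_on {0..b0} m"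
    unfolding m_def [abs_def] by (rule lipschitz_on_compose2 [OF L])
  have "(max L (K\<^sup>2 * L))-lipschitz_on {0..b0} Y" "(max L (K\<^sup>2 * L))-lipschitz_on {0..b0} m"
    by (rule lipschitz_on_le [OF LY], simp, rule lipschitz_on_le [OF Lm], simp)
  then show ?thesis
    by (rule that [OF b0 _ _ bound sol])
qed

section \<open>The bifurcating branch\<close>

text \<open>Reverses the division by powers of b. The smallness of \<open>f\<close> bounds the
  function by a number below 1, which keeps 1 + cnj u away from zero.\<close>

lemma filament_solution_of_reduced:
  assumes sol: "reduced_solution b (Y, V, m)"
    and f: "f = b *\<^sub>R (profile + b *\<^sub>R Y)" and small: "norm f < 1"
  shows "filament_solution q (\<omega>0 + b\<^sup>2 * m) (fourier_sum f)"
proof (rule filament_solution_fourier_sum)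
  define \<omega> where "\<omega> = \<omega>0 + b\<^sup>2 * m"
  define F where "F = residual b (Y, V, m)"
  define g where "g = b\<^sup>2 *\<^sub>R (\<omega> *\<^sub>R square + b *\<^sub>R V)"
  have Y: "Y = - pinv F" and F: "solvability F = 0"
    and V: "V = (2 * \<omega>) *\<^sub>R conv cprofile (time_reverse Y) + (b * \<omega>) *\<^sub>R conv (time_reverse Y) (time_reverse Y)
       - conv (cprofile + b *\<^sub>R time_reverse Y) (\<omega> *\<^sub>R square + b *\<^sub>R V)"
    using sol by (auto simp: reduced_solution_def F_def \<omega>_def)
  show "(of_int (fst p) / real q + (of_int (snd p))\<^sup>2) * coef f p
      + (\<omega>0 + b\<^sup>2 * m) * (coef f p + coef f (flip p)) + coef g p = 0" for p
  proof -
    have Yp: "diag p * coef Y p + \<omega>0 * coef Y (flip p) = - coef F p"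
      using pinv_solves [OF F, of p] by (simp add: Y)
    have Fp: "coef F p = \<omega> * coef square p + b * (m * (coef profile p + coef profile (flip p)
        + b * (coef Y p + coef Y (flip p))) + coef V p)"
      by (simp add: F_def residual_def \<omega>_def)
    have "(of_int (fst p) / real q + (of_int (snd p))\<^sup>2) * coef f p
        + (\<omega>0 + b\<^sup>2 * m) * (coef f p + coef f (flip p)) + coef g p
      = b * (diag p * coef profile p + \<omega>0 * coef profile (flip p))
        + b\<^sup>2 * (diag p * coef Y p + \<omega>0 * coef Y (flip p)) + b\<^sup>2 * coef F p"
      unfolding Fp by (simp add: f g_def diag_def algebra_simps power2_eq_square)
    then show ?thesis
      unfolding profile_kernel Yp by simp
  qed
  show "fourier_sum g x * (1 + cnj (fourier_sum f x)) = of_real (\<omega>0 + b\<^sup>2 * m) * (cnj (fourier_sum f x))\<^sup>2" for x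
  proof -
    define w z y v where "w = complex_of_real \<omega>" and "z = cnj (fourier_sum profile x)"
      and "y = cnj (fourier_sum Y x)" and "v = fourier_sum V x"
    let ?b = "complex_of_real b"
    have "v = 2 * w * z * y + ?b * w * y\<^sup>2 - (z + ?b * y) * (w * z\<^sup>2 + ?b * v)"
      unfolding v_def by (subst V)
        (simp add: fourier_sum_add fourier_sum_diff fourier_sum_scaleR fourier_sum_conv fourier_sum_time_reverse
          w_def z_def y_def power2_eq_square algebra_simps)
    then have v: "v + (z + ?b * y) * (w * z\<^sup>2 + ?b * v) = 2 * w * z * y + ?b * w * y\<^sup>2"
      by (metis diff_add_cancel)
    have "fourier_sum g x * (1 + cnj (fourier_sum f x))
        = ?b\<^sup>2 * (w * z\<^sup>2 + ?b * v) * (1 + ?b * (z + ?b * y))"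
      by (simp add: g_def f fourier_sum_add fourier_sum_scaleR fourier_sum_conv fourier_sum_time_reverse
          w_def z_def y_def v_def power2_eq_square)
    also have "\<dots> = ?b\<^sup>2 * w * z\<^sup>2 + ?b ^ 3 * (v + (z + ?b * y) * (w * z\<^sup>2 + ?b * v))"
      by (simp add: power2_eq_square power3_eq_cube algebra_simps)
    also have "\<dots> = w * (?b * (z + ?b * y))\<^sup>2"
      unfolding v by (simp add: power2_eq_square power3_eq_cube algebra_simps)
    also have "\<dots> = of_real (\<omega>0 + b\<^sup>2 * m) * (cnj (fourier_sum f x))\<^sup>2"
      by (simp add: f fourier_sum_add fourier_sum_scaleR w_def z_def y_def \<omega>_def)
    finally show ?thesis .
  qed
  show "1 + cnj (fourier_sum f x) \<noteq> 0" for x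
  proof
    assume "1 + cnj (fourier_sum f x) = 0"
    then have "cnj (fourier_sum f x) = - 1"
      by (simp add: add_eq_0_iff)
    then have "norm (fourier_sum f x) = 1"
      by (metis complex_mod_cnj norm_minus_cancel norm_one)
    then show False
      using norm_fourier_sum_le [of f x] small by simp
  qed
qed

lemma coef_reduced_solution:
  "reduced_solution b (Y, V, m) \<Longrightarrow> coef Y (j0, int k0) = 0"
  unfolding reduced_solution_def by (metis (mono_tags, lifting) case_prodD coef_uminus coef_pinv_j0 minus_zero)

end

theorem theorem1:
  fixes q k0 :: nat and \<sigma> :: real
  assumes "q \<ge> 1" and "k0 \<ge> 1" and "\<sigma> > 1"
  shows "\<exists>b0 > 0. \<exists>(u :: real \<Rightarrow> real \<times> real \<Rightarrow> complex) (\<omega> :: real \<Rightarrow> real) (C :: real).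
      u 0 = (\<lambda>_. 0) \<and> \<omega> 0 = omega0 q k0 \<and>
      (\<forall>b\<in>{0<..b0}. u b \<noteq> (\<lambda>_. 0)) \<and>
      inj_on (\<lambda>b. (u b, \<omega> b)) {0..b0} \<and>
      continuous_on {0..b0} \<omega> \<and>
      (\<forall>b\<in>{0..b0}. ((\<lambda>b'. sobolev_norm \<sigma> (\<lambda>x. u b' x - u b x)) \<longlongrightarrow> 0) (at b within {0..b0})) \<and>
      (\<forall>b\<in>{0..b0}.
         u b \<in> sobolev_space \<sigma> \<and> \<omega> b < 0 \<and> filament_solution q (\<omega> b) (u b) \<and>
         (\<forall>t s. u b (t, s) = cnj (u b (- t, s)) \<and> u b (t, s) = u b (t, - s)) \<and>
         sobolev_norm \<sigma> (\<lambda>x. u b x - complex_of_real b * leading_profile q k0 x) \<le> C * b\<^sup>2 \<and>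
         \<bar>\<omega> b - omega0 q k0\<bar> \<le> C * b\<^sup>2)"
proof -
  interpret bifurcation q k0
    using assms by unfold_locales auto
  obtain b1 r L Y V m where b1: "0 < b1" "b1 \<le> 1"
    and LY: "L-lipschitz_on {0..b1} Y" and Lm: "L-lipschitz_on {0..b1} m"
    and r: "\<And>b. b \<in> {0..b1} \<Longrightarrow> norm (Y b) \<le> r \<and> \<bar>m b\<bar> \<le> r"
    and sol: "\<And>b. b \<in> {0..b1} \<Longrightarrow> reduced_solution b (Y b, V b, m b)"
    by (rule reduced_solution_branch) blast
  obtain K where K: "K > 0" "\<And>f. fourier_sum f \<in> sobolev_space \<sigma>"
    "\<And>f. sobolev_norm \<sigma> (fourier_sum f) \<le> K * norm f"
    using sobolev_fourier_sum [of \<sigma>] assms(3) by auto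
  have r0: "r \<ge> 0"
    using r [of 0] b1 by (auto intro: order_trans [OF norm_ge_zero])
  define M where "M = norm profile + r + 1"
  \<comment> \<open>The three bounds provide the branch, \<open>norm (f b) < 1\<close>, and a
    negative frequency; the last also uses b^2 <= b0, which follows from b0 <= 1.\<close>
  define b0 where "b0 = min b1 (min (1 / (2 * M)) (\<bar>\<omega>0\<bar> / (r + 1)))"
  have M: "M > 0" using r0 by (simp add: M_def add_nonneg_pos)
  have b0: "0 < b0" "b0 \<le> b1" "b0 * M < 1" "b0 * r < \<bar>\<omega>0\<bar>"
  proof -
    show "0 < b0" "b0 \<le> b1"
      using b1 M r0 \<omega>0_bounds(1) by (auto simp: b0_def divide_neg_pos)
    have "b0 * M \<le> 1 / (2 * M) * M"
      using M by (intro mult_right_mono) (auto simp: b0_def)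
    then show "b0 * M < 1" using M by simp
    have "b0 * r < b0 * (r + 1)"
      using \<open>0 < b0\<close> by simp
    also have "\<dots> \<le> \<bar>\<omega>0\<bar> / (r + 1) * (r + 1)"
      using r0 by (intro mult_right_mono) (auto simp: b0_def)
    also have "\<dots> = \<bar>\<omega>0\<bar>" using r0 by simp
    finally show "b0 * r < \<bar>\<omega>0\<bar>" .
  qed
  define f where "f b = b *\<^sub>R (profile + b *\<^sub>R Y b)" for b
  define u where "u b = fourier_sum (f b)" for b
  define \<omega> where "\<omega> b = \<omega>0 + b\<^sup>2 * m b" for b
  have in1: "b \<in> {0..b1}" if "b \<in> {0..b0}" for b
    using that b0(2) by auto
  have f_diff: "fourier_sum (f b' - f b) = (\<lambda>x. u b' x - u b x)" for b b'
    by (simp add: u_def fourier_sum_diff fun_eq_iff)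
  have cont_Y: "continuous_on {0..b0} Y" and cont_m: "continuous_on {0..b0} m"
    using lipschitz_on_continuous_on [OF LY] lipschitz_on_continuous_on [OF Lm] b0(2)
    by (auto elim: continuous_on_subset)
  have cont_f: "continuous_on {0..b0} f"
    unfolding f_def by (intro continuous_intros cont_Y)
  have coef_u: "fourier_coeff (u b) (j0, int k0) = of_real (b * coef profile (j0, int k0))"
    if "b \<in> {0..b0}" for b
    using coef_reduced_solution [OF sol [OF in1 [OF that]]]
    by (simp add: u_def fourier_coeff_fourier_sum f_def)
  \<comment> \<open>The coefficient at \<open>(j0, int k0)\<close> is b times a positive constant,
    so u alone determines b.\<close>
  have inj: "b = b'" if "b \<in> {0..b0}" "b' \<in> {0..b0}" "u b = u b'" for b b'
  proof -
    have "complex_of_real (b * coef profile (j0, int k0)) = of_real (b' * coef profile (j0, int k0))"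
      using that(3) unfolding coef_u [OF that(1), symmetric] coef_u [OF that(2), symmetric] by simp
    then show ?thesis
      using coef_profile_j0 unfolding of_real_eq_iff by simp
  qed
  have u0: "u 0 = (\<lambda>_. 0)"
    by (simp add: u_def f_def fun_eq_iff)
  have \<omega>_le: "\<bar>\<omega> b - \<omega>0\<bar> \<le> r * b\<^sup>2" if "b \<in> {0..b0}" for b
    using r [OF in1 [OF that]] by (simp add: \<omega>_def abs_mult mult.commute mult_right_mono)
  have sq: "b\<^sup>2 \<le> b0" if "b \<in> {0..b0}" for b
  proof -
    have "b * b \<le> b0 * 1"
      using that b0 b1 by (intro mult_mono) auto
    then show ?thesis by (simp add: power2_eq_square)
  qed
  have main: "u b \<in> sobolev_space \<sigma> \<and> \<omega> b < 0 \<and> filament_solution q (\<omega> b) (u b) \<and>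
         (\<forall>t s. u b (t, s) = cnj (u b (- t, s)) \<and> u b (t, s) = u b (t, - s)) \<and>
         sobolev_norm \<sigma> (\<lambda>x. u b x - complex_of_real b * leading_profile q k0 x) \<le> max (K * r) r * b\<^sup>2 \<and>
         \<bar>\<omega> b - omega0 q k0\<bar> \<le> max (K * r) r * b\<^sup>2" if b: "b \<in> {0..b0}" for b
  proof (intro conjI allI)
    show "u b \<in> sobolev_space \<sigma>"
      unfolding u_def by (rule K)
    have "r * b\<^sup>2 \<le> r * b0"
      using sq [OF b] r0 by (rule mult_left_mono)
    then show "\<omega> b < 0"
      using \<omega>_le [OF b] b0(4) \<omega>0_bounds(1) by (simp add: mult.commute)
    have "norm (f b) \<le> b * (norm profile + b * norm (Y b))"
      using b norm_triangle_ineq [of profile "b *\<^sub>R Y b"] by (simp add: f_def mult_left_mono)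
    also have "\<dots> \<le> b0 * M"
    proof (intro mult_mono)
      have "b * norm (Y b) \<le> 1 * r"
        using b r [OF in1 [OF b]] b0 b1 r0 by (intro mult_mono) auto
      then show "norm profile + b * norm (Y b) \<le> M"
        by (simp add: M_def)
    qed (use b b0 in auto)
    finally have "norm (f b) < 1"
      using b0(3) by simp
    then show "filament_solution q (\<omega> b) (u b)"
      unfolding \<omega>_def u_def
      by (intro filament_solution_of_reduced [OF sol [OF in1 [OF b]]] f_def)
    show "u b (t, s) = cnj (u b (- t, s))" "u b (t, s) = u b (t, - s)" for t s
      by (simp_all add: u_def fourier_sum_reflect fourier_sum_even)
    \<comment> \<open>The remainder is exactly b^2 Y, so the estimate needs only the uniform bound
      on Y.\<close>
    have "(\<lambda>x. u b x - complex_of_real b * leading_profile q k0 x) = fourier_sum (b\<^sup>2 *\<^sub>R Y b)"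
      by (simp add: u_def f_def fourier_sum_profile [symmetric] fourier_sum_add fourier_sum_scaleR
          fun_eq_iff power2_eq_square algebra_simps)
    then have "sobolev_norm \<sigma> (\<lambda>x. u b x - complex_of_real b * leading_profile q k0 x) \<le> K * (b\<^sup>2 * norm (Y b))"
      using K(3) [of "b\<^sup>2 *\<^sub>R Y b"] by simp
    also have "\<dots> \<le> K * (b\<^sup>2 * r)"
      using r [OF in1 [OF b]] K(1) by (intro mult_left_mono) auto
    also have "\<dots> \<le> max (K * r) r * b\<^sup>2"
      using mult_right_mono [of "K * r" "max (K * r) r" "b\<^sup>2"] by (simp add: mult_ac)
    finally show "sobolev_norm \<sigma> (\<lambda>x. u b x - complex_of_real b * leading_profile q k0 x) \<le> max (K * r) r * b\<^sup>2" .
    have "r * b\<^sup>2 \<le> max (K * r) r * b\<^sup>2"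
      by (intro mult_right_mono) auto
    then show "\<bar>\<omega> b - omega0 q k0\<bar> \<le> max (K * r) r * b\<^sup>2"
      using \<omega>_le [OF b] by (simp add: \<omega>0_def)
  qed
  have lim: "((\<lambda>b'. sobolev_norm \<sigma> (\<lambda>x. u b' x - u b x)) \<longlongrightarrow> 0) (at b within {0..b0})"
    if b: "b \<in> {0..b0}" for b
  proof (rule tendsto_sandwich [where f = "\<lambda>_. 0" and h = "\<lambda>b'. K * norm (f b' - f b)"])
    have "(f \<longlongrightarrow> f b) (at b within {0..b0})"
      using cont_f b by (simp add: continuous_on)
    then show "((\<lambda>b'. K * norm (f b' - f b)) \<longlongrightarrow> 0) (at b within {0..b0})"
      by (intro tendsto_mult_right_zero tendsto_norm_zero) (rule Lim_null [THEN iffD1])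
    show "\<forall>\<^sub>F b' in at b within {0..b0}. sobolev_norm \<sigma> (\<lambda>x. u b' x - u b x) \<le> K * norm (f b' - f b)"
      unfolding f_diff [symmetric] by (intro always_eventually allI K(3))
    show "\<forall>\<^sub>F b' in at b within {0..b0}. 0 \<le> sobolev_norm \<sigma> (\<lambda>x. u b' x - u b x)"
      unfolding sobolev_norm_def
      by (intro always_eventually allI real_sqrt_ge_zero infsum_nonneg) (auto simp: sobolev_term_def)
  qed auto
  show ?thesis
  proof (rule exI [of _ b0], intro conjI exI [of _ u] exI [of _ \<omega>] exI [of _ "max (K * r) r"] b0(1))
    show "\<omega> 0 = omega0 q k0"
      by (simp add: \<omega>_def \<omega>0_def)
    show "\<forall>b\<in>{0<..b0}. u b \<noteq> (\<lambda>_. 0)"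
    proof
      fix b assume b: "b \<in> {0<..b0}"
      then show "u b \<noteq> (\<lambda>_. 0)"
        using inj [of b 0] u0 by auto
    qed
    show "inj_on (\<lambda>b. (u b, \<omega> b)) {0..b0}"
      by (rule inj_onI, rule inj) auto
    show "continuous_on {0..b0} \<omega>"
      unfolding \<omega>_def by (intro continuous_intros cont_m)
  qed (rule u0 ballI, (rule u0 ballI lim main | assumption)+)
qed

end
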